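(* Fix positive integers $n,a$. Consider the signed shuffle algebra and let $\mathcal B_n$ be the set of $2^nn!$ signed permutations of $n$. For each of the linear maps $\frac1{a^n}\tau^+_a,\frac1{a^n}\tau^-_a,\frac1{a^n}\tilde\tau^+_a,\frac1{a^n}\tilde\tau^-_a$ restricted to the span of $\mathcal B_n$ (equivalently, the transition matrix of the corresponding hyperoctahedral riffle-shuffle with rotation or flip), the eigenvalues and their algebraic multiplicities are as follows, writing $[x^k]f$ for the coefficient of $x^k$ in $f$: - $a$ even, any of the four maps: eigenvalue $a^{k-n}$ with multiplicity $[x^k]\,x(x+2)(x+4)\cdots(x+2n-2)$, and eigenvalue $0$ with multiplicity $2^nn!-\frac{(2n)!}{2^nn!}$; - $a$ odd, $\frac1{a^n}\tau^+_a$ or $\frac1{a^n}\tilde\tau^+_a$: eigenvalue $a^{k-n}$ with multiplicity $[x^k]\,(x+1)(x+3)\cdots(x+2n-1)$; - $a$ odd, $\frac1{a^n}\tau^-_a$ or $\frac1{a^n}\tilde\tau^-_a$: eigenvalue $a^{k-n}$ with multiplicity $[x^k]\,(x+n-1)(x+1)(x+3)\cdots(x+2n-3)$, and eigenvalue $-a^{k-n}$ with multiplicity $[x^k]\,n(x+1)(x+3)\cdots(x+2n-3)$.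
   Context: Alphabet $\mathcal A=\{1,\dots,N,\bar1,\dots,\bar N\}$ with $N\ge n$. The signed shuffle algebra has as basis all words on $\mathcal A$ (degree = length), product of two words = sum of all their interleavings (words containing the letters of both in their original relative orders, with multiplicity), coproduct deconcatenation $\Delta(w_1\cdots w_n)=\sum_{i=0}^nw_1\cdots w_i\otimes w_{i+1}\cdots w_n$. Iterated products are written $m$ and $\Delta^{[a]}$ is the iterated coproduct. Define $\tau(w_1\cdots w_n)=\tau(w_1)\cdots\tau(w_n)$ and $\tilde\tau(w_1\cdots w_n)=\tilde\tau(w_n)\cdots\tilde\tau(w_1)$, where on letters $i\mapsto\bar i$, $\bar i\mapsto i$ (rotation, resp. flipping of a deck). For an involution $\theta\in\{\tau,\tilde\tau\}$, $\theta^+_a=m\circ(\mathrm{id}\otimes\theta\otimes\mathrm{id}\otimes\theta\otimes\cdots)\circ\Delta^{[a]}$ and $\theta^-_a=m\circ(\theta\otimes\mathrm{id}\otimes\theta\otimes\mathrm{id}\otimes\cdots)\circ\Delta^{[a]}$ (with $a$ alternating tensor factors). A signed permutation of $n$ is a word of length $n$ in which, for each $i\in\{1,\dots,n\}$, exactly one of $i,\bar i$ appears exactly once; the span of $\mathcal B_n$ is invariant under these operators. *)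

theory Defs
  imports
    Complex_Main
    "HOL-Library.Poly_Mapping"
    "HOL-Library.Multiset"
    "HOL-Computational_Algebra.Polynomial"
    "Jordan_Normal_Form.Char_Poly"
begin

section \<open>Free vector spaces\<close>

text \<open>The complex vector space with basis \<open>'b\<close> is the type \<open>'b \<Rightarrow>\<^sub>0 complex\<close> of finitely supported
  functions.\<close>

type_synonym 'b freevec = "'b \<Rightarrow>\<^sub>0 complex"

definition basis_vec :: "'b \<Rightarrow> 'b freevec" where
  "basis_vec b = Poly_Mapping.single b 1"

definition scale_vec :: "complex \<Rightarrow> 'b freevec \<Rightarrow> 'b freevec" where
  "scale_vec c x = Poly_Mapping.map (\<lambda>y. c * y) x"

definition lin_ext :: "('b \<Rightarrow> 'c freevec) \<Rightarrow> 'b freevec \<Rightarrow> 'c freevec" where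
  "lin_ext f x = (\<Sum>b\<in>Poly_Mapping.keys x. scale_vec (Poly_Mapping.lookup x b) (f b))"

definition span_of :: "'b set \<Rightarrow> 'b freevec set" where
  "span_of S = {x. Poly_Mapping.keys x \<subseteq> S}"

section \<open>Words, shuffle product and deconcatenation\<close>

datatype letter = Plain nat | Barred nat

fun bar :: "letter \<Rightarrow> letter" where
  "bar (Plain i) = Barred i"
| "bar (Barred i) = Plain i"

definition alphabet :: "nat \<Rightarrow> letter set" where
  "alphabet N = Plain ` {1..N} \<union> Barred ` {1..N}"

type_synonym word = "letter list"

text \<open>All interleavings with multiplicity (the library's \<open>shuffles\<close> is only the set of them).\<close>

fun interleavings :: "word \<Rightarrow> word \<Rightarrow> word multiset" where
  "interleavings [] v = {#v#}"
| "interleavings (x # u) [] = {#x # u#}"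
| "interleavings (x # u) (y # v) =
     image_mset (\<lambda>w. x # w) (interleavings u (y # v)) +
     image_mset (\<lambda>w. y # w) (interleavings (x # u) v)"

definition shuffle_prod :: "word freevec \<Rightarrow> word freevec \<Rightarrow> word freevec" where
  "shuffle_prod x y =
     lin_ext (\<lambda>u. lin_ext (\<lambda>v. \<Sum>w\<in>#interleavings u v. basis_vec w) y) x"

text \<open>Elementary tensors \<open>w\<^sub>1 \<otimes> \<dots> \<otimes> w\<^sub>a\<close> of words are the lists \<open>[w\<^sub>1, \<dots>, w\<^sub>a]\<close>, so the tensor powers
  of the shuffle algebra are subspaces of \<open>word list freevec\<close>. The map below is
  \<open>\<Delta> \<otimes> id \<otimes> \<dots> \<otimes> id\<close>, with \<open>\<Delta>\<close> the deconcatenation coproduct.\<close>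

definition coprod_first :: "word list freevec \<Rightarrow> word list freevec" where
  "coprod_first = lin_ext (\<lambda>ws. \<Sum>i\<le>length (hd ws).
     basis_vec (take i (hd ws) # drop i (hd ws) # tl ws))"

text \<open>\<open>\<Delta>\<^bsup>[a]\<^esup>\<close> with values in the \<open>a\<close>-fold tensor power, for \<open>a \<ge> 1\<close>; \<open>\<Delta>\<^bsup>[1]\<^esup> = id\<close>.\<close>

definition iter_coprod :: "nat \<Rightarrow> word freevec \<Rightarrow> word list freevec" where
  "iter_coprod a x = (coprod_first ^^ (a - 1)) (lin_ext (\<lambda>w. basis_vec [w]) x)"

definition iter_prod :: "word list freevec \<Rightarrow> word freevec" where
  "iter_prod = lin_ext (\<lambda>ws. foldr shuffle_prod (map basis_vec ws) (basis_vec []))"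

section \<open>Rotation, flipping and the alternating operators\<close>

definition rot :: "word \<Rightarrow> word" where
  "rot w = map bar w"

definition flip :: "word \<Rightarrow> word" where
  "flip w = rev (map bar w)"

text \<open>\<open>id \<otimes> \<theta> \<otimes> id \<otimes> \<dots>\<close> and \<open>\<theta> \<otimes> id \<otimes> \<theta> \<otimes> \<dots>\<close>, for \<open>\<theta>\<close> given by its action on words.\<close>

definition alt_plus :: "(word \<Rightarrow> word) \<Rightarrow> word list freevec \<Rightarrow> word list freevec" where
  "alt_plus \<theta> = lin_ext (\<lambda>ws. basis_vec
     (map (\<lambda>j. if even j then ws ! j else \<theta> (ws ! j)) [0..<length ws]))"

definition alt_minus :: "(word \<Rightarrow> word) \<Rightarrow> word list freevec \<Rightarrow> word list freevec" where
  "alt_minus \<theta> = lin_ext (\<lambda>ws. basis_vec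
     (map (\<lambda>j. if even j then \<theta> (ws ! j) else ws ! j) [0..<length ws]))"

definition theta_plus :: "(word \<Rightarrow> word) \<Rightarrow> nat \<Rightarrow> word freevec \<Rightarrow> word freevec" where
  "theta_plus \<theta> a x = iter_prod (alt_plus \<theta> (iter_coprod a x))"

definition theta_minus :: "(word \<Rightarrow> word) \<Rightarrow> nat \<Rightarrow> word freevec \<Rightarrow> word freevec" where
  "theta_minus \<theta> a x = iter_prod (alt_minus \<theta> (iter_coprod a x))"

definition normalized :: "nat \<Rightarrow> nat \<Rightarrow> (word freevec \<Rightarrow> word freevec) \<Rightarrow> word freevec \<Rightarrow> word freevec" where
  "normalized n a T x = scale_vec (1 / of_nat a ^ n) (T x)"

section \<open>Signed permutations and eigenvalues\<close>

definition signed_perms :: "nat \<Rightarrow> nat \<Rightarrow> word set" where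
  "signed_perms N n = {w \<in> lists (alphabet N). length w = n \<and>
     (\<forall>i\<in>{1..n}. (count_list w (Plain i) = 1 \<and> count_list w (Barred i) = 0) \<or>
                  (count_list w (Plain i) = 0 \<and> count_list w (Barred i) = 1))}"

text \<open>Column \<open>j\<close> holds the coordinates of the image of the \<open>j\<close>-th basis word. When the span of
  \<open>set bs\<close> is invariant under \<open>T\<close> this is the matrix of the restriction of \<open>T\<close> to that span.\<close>

definition matrix_on :: "'b list \<Rightarrow> ('b freevec \<Rightarrow> 'b freevec) \<Rightarrow> complex mat" where
  "matrix_on bs T = mat (length bs) (length bs)
     (\<lambda>(i, j). Poly_Mapping.lookup (T (basis_vec (bs ! j))) (bs ! i))"

text \<open>The multiset of eigenvalues, each repeated according to its algebraic multiplicity.\<close>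

definition eigenvalue_mset :: "complex mat \<Rightarrow> complex multiset" where
  "eigenvalue_mset A = proots (char_poly A)"

lemma count_eigenvalue_mset:
  assumes "A \<in> carrier_mat d d"
  shows "count (eigenvalue_mset A) c = order c (char_poly A)"
proof -
  have "char_poly A \<noteq> 0"
    using degree_monic_char_poly[OF assms] by auto
  thus ?thesis by (simp add: eigenvalue_mset_def)
qed

lemma in_eigenvalue_mset_iff:
  assumes "A \<in> carrier_mat d d"
  shows "c \<in># eigenvalue_mset A \<longleftrightarrow> eigenvalue A c"
proof -
  have "char_poly A \<noteq> 0"
    using degree_monic_char_poly[OF assms] by auto
  thus ?thesis
    using eigenvalue_root_char_poly[OF assms, of c] by (simp add: eigenvalue_mset_def)
qed

section \<open>Invariance of the span of the signed permutations\<close>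

lemma lookup_scale_vec [simp]:
  "Poly_Mapping.lookup (scale_vec c x) b = c * Poly_Mapping.lookup x b"
  unfolding scale_vec_def by transfer (simp add: when_def)

lemma scale_vec_in_span: "x \<in> span_of S \<Longrightarrow> scale_vec c x \<in> span_of S"
  by (auto simp: span_of_def in_keys_iff)

lemma basis_vec_in_span: "b \<in> S \<Longrightarrow> basis_vec b \<in> span_of S"
  by (simp add: span_of_def basis_vec_def)

lemma sum_in_span: "(\<And>i. i \<in> I \<Longrightarrow> f i \<in> span_of S) \<Longrightarrow> sum f I \<in> span_of S"
  using keys_sum[of f I] by (fastforce simp: span_of_def)

lemma sum_mset_in_span: "(\<And>i. i \<in># M \<Longrightarrow> f i \<in> span_of S) \<Longrightarrow> (\<Sum>i\<in>#M. f i) \<in> span_of S"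
proof (induction M)
  case empty
  show ?case by (simp add: span_of_def)
next
  case (add y M)
  have "f y \<in> span_of S" "(\<Sum>i\<in>#M. f i) \<in> span_of S"
    using add by auto
  thus ?case
    using keys_add[of "f y" "\<Sum>i\<in>#M. f i"] by (fastforce simp: span_of_def)
qed

lemma lin_ext_in_span:
  assumes "x \<in> span_of S" "\<And>b. b \<in> S \<Longrightarrow> f b \<in> span_of S'"
  shows "lin_ext f x \<in> span_of S'"
  unfolding lin_ext_def
  by (rule sum_in_span, rule scale_vec_in_span) (use assms in \<open>auto simp: span_of_def\<close>)

fun unbar :: "letter \<Rightarrow> nat" where
  "unbar (Plain i) = i"
| "unbar (Barred i) = i"

definition letter_content :: "word \<Rightarrow> nat multiset" where
  "letter_content w = mset (map unbar w)"

lemma unbar_bar [simp]: "unbar (bar x) = unbar x"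
  by (cases x) auto

lemma letter_content_rot [simp]: "letter_content (rot w) = letter_content w"
  by (simp add: letter_content_def rot_def o_def)

lemma letter_content_flip [simp]: "letter_content (flip w) = letter_content w"
  by (simp add: letter_content_def flip_def rev_map o_def)

lemma letter_content_interleavings:
  "w \<in># interleavings u v \<Longrightarrow> letter_content w = letter_content u + letter_content v"
  by (induction u v arbitrary: w rule: interleavings.induct) (auto simp: letter_content_def)

lemma shuffle_prod_in_span:
  assumes "x \<in> span_of {w. letter_content w = M}" "y \<in> span_of {w. letter_content w = M'}"
  shows "shuffle_prod x y \<in> span_of {w. letter_content w = M + M'}"
  unfolding shuffle_prod_def
  by (rule lin_ext_in_span[OF assms(1)], rule lin_ext_in_span[OF assms(2)],
      rule sum_mset_in_span, rule basis_vec_in_span)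
     (auto dest: letter_content_interleavings)

definition tensor_content :: "word list \<Rightarrow> nat multiset" where
  "tensor_content ws = sum_list (map letter_content ws)"

lemma iter_prod_in_span:
  assumes "x \<in> span_of {ws. tensor_content ws = M}"
  shows "iter_prod x \<in> span_of {w. letter_content w = M}"
proof -
  have "foldr shuffle_prod (map basis_vec ws) (basis_vec []) \<in> span_of {w. letter_content w = tensor_content ws}"
    for ws
  proof (induction ws)
    case Nil
    show ?case by (simp add: tensor_content_def basis_vec_in_span letter_content_def)
  next
    case (Cons u ws)
    show ?case
      using shuffle_prod_in_span[OF basis_vec_in_span Cons, of u "letter_content u"]
      by (simp add: tensor_content_def)
  qed
  thus ?thesis unfolding iter_prod_def by (intro lin_ext_in_span[OF assms]) auto
qed

lemma iter_coprod_in_span: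
  assumes "x \<in> span_of {w. letter_content w = M}"
  shows "iter_coprod a x \<in> span_of {ws. ws \<noteq> [] \<and> tensor_content ws = M}"
proof -
  have step: "coprod_first y \<in> span_of {ws. ws \<noteq> [] \<and> tensor_content ws = M}"
    if "y \<in> span_of {ws. ws \<noteq> [] \<and> tensor_content ws = M}" for y
    unfolding coprod_first_def
  proof (rule lin_ext_in_span[OF that], rule sum_in_span, rule basis_vec_in_span)
    fix ws :: "word list" and i
    assume "ws \<in> {ws. ws \<noteq> [] \<and> tensor_content ws = M}"
    moreover have "letter_content (take i u) + letter_content (drop i u) = letter_content u" for u
      unfolding letter_content_def by (metis append_take_drop_id map_append mset_append)
    ultimately show "take i (hd ws) # drop i (hd ws) # tl ws \<in> {ws. ws \<noteq> [] \<and> tensor_content ws = M}"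
      by (cases ws) (auto simp: tensor_content_def simp flip: add.assoc)
  qed
  have base: "lin_ext (\<lambda>w. basis_vec [w]) x \<in> span_of {ws. ws \<noteq> [] \<and> tensor_content ws = M}"
    by (rule lin_ext_in_span[OF assms], rule basis_vec_in_span) (simp add: tensor_content_def)
  have "(coprod_first ^^ m) (lin_ext (\<lambda>w. basis_vec [w]) x)
          \<in> span_of {ws. ws \<noteq> [] \<and> tensor_content ws = M}" for m
    by (induction m) (use base step in auto)
  thus ?thesis unfolding iter_coprod_def .
qed

lemma tensor_content_map_upt:
  assumes "\<And>j. j < length ws \<Longrightarrow> letter_content (f j) = letter_content (ws ! j)"
  shows "tensor_content (map f [0..<length ws]) = tensor_content ws"
proof -
  have "map (letter_content \<circ> f) [0..<length ws] = map letter_content ws"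
    by (rule nth_equalityI) (use assms in auto)
  thus ?thesis by (simp add: tensor_content_def)
qed

lemma theta_in_span:
  assumes "x \<in> span_of {w. letter_content w = M}" "\<theta> \<in> {rot, flip}"
  shows "theta_plus \<theta> a x \<in> span_of {w. letter_content w = M}"
    and "theta_minus \<theta> a x \<in> span_of {w. letter_content w = M}"
proof -
  have [simp]: "letter_content (\<theta> w) = letter_content w" for w
    using assms(2) by auto
  show "theta_plus \<theta> a x \<in> span_of {w. letter_content w = M}"
    unfolding theta_plus_def alt_plus_def
    by (rule iter_prod_in_span, rule lin_ext_in_span[OF iter_coprod_in_span[OF assms(1)]],
        rule basis_vec_in_span) (auto simp: tensor_content_map_upt)
  show "theta_minus \<theta> a x \<in> span_of {w. letter_content w = M}"
    unfolding theta_minus_def alt_minus_def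
    by (rule iter_prod_in_span, rule lin_ext_in_span[OF iter_coprod_in_span[OF assms(1)]],
        rule basis_vec_in_span) (auto simp: tensor_content_map_upt)
qed

lemma count_letter_content: "count (letter_content w) i = count_list w (Plain i) + count_list w (Barred i)"
proof (induction w)
  case (Cons x w)
  thus ?case by (cases x) (auto simp: letter_content_def)
qed (simp add: letter_content_def)

lemma signed_perms_eq:
  assumes "n \<le> N"
  shows "signed_perms N n = {w. letter_content w = mset_set {1..n}}"
proof (intro equalityI subsetI)
  fix w assume w: "w \<in> signed_perms N n"
  have "mset_set {1..n} \<subseteq># letter_content w"
  proof (rule mset_subset_eqI)
    fix i
    show "count (mset_set {1..n}) i \<le> count (letter_content w) i"
    proof (cases "i \<in> {1..n}")
      case True
      hence "count (letter_content w) i = 1"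
        using w unfolding signed_perms_def count_letter_content by fastforce
      thus ?thesis using True by simp
    qed auto
  qed
  moreover have "size (letter_content w) = size (mset_set {1..n})"
    using w by (simp add: signed_perms_def letter_content_def)
  ultimately show "w \<in> {w. letter_content w = mset_set {1..n}}"
    using mset_subset_size[of "mset_set {1..n}" "letter_content w"]
    by (auto simp: subset_mset.le_less)
next
  fix w assume "w \<in> {w. letter_content w = mset_set {1..n}}"
  hence w: "letter_content w = mset_set {1..n}" by simp
  have len: "length w = n"
    using arg_cong[OF w, of size] by (simp add: letter_content_def)
  have "x \<in> alphabet N" if "x \<in> set w" for x
  proof -
    have "unbar x \<in># letter_content w" using that by (auto simp: letter_content_def)
    hence "unbar x \<in> {1..N}" using w assms by auto
    thus ?thesis by (cases x) (auto simp: alphabet_def)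
  qed
  moreover have "count_list w (Plain i) + count_list w (Barred i) = 1" if "i \<in> {1..n}" for i
    using that w count_letter_content[of w i] by simp
  ultimately show "w \<in> signed_perms N n"
    using len unfolding signed_perms_def in_lists_conv_set mem_Collect_eq
    by (simp only: add_is_1 One_nat_def) blast
qed

lemma finite_signed_perms: "finite (signed_perms N n)"
proof (rule finite_subset)
  show "signed_perms N n \<subseteq> {w. set w \<subseteq> alphabet N \<and> length w = n}"
    by (auto simp: signed_perms_def)
  show "finite {w. set w \<subseteq> alphabet N \<and> length w = n}"
    by (rule finite_lists_length_eq) (simp add: alphabet_def)
qed

lemma span_signed_perms_invariant:
  assumes "n \<le> N" "\<theta> \<in> {rot, flip}" "x \<in> span_of (signed_perms N n)"
  shows "theta_plus \<theta> a x \<in> span_of (signed_perms N n)"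
    and "theta_minus \<theta> a x \<in> span_of (signed_perms N n)"
  using theta_in_span[OF _ assms(2)] assms(3) unfolding signed_perms_eq[OF assms(1)] by auto

end

theory Submission
  imports Defs "Jordan_Normal_Form.Schur_Decomposition" "HOL-Combinatorics.Multiset_Permutations"
begin

text \<open>The eigenvalues are read off from the traces of all powers. The coefficient of \<open>v\<close> in the
  image of \<open>w\<close> counts the ways of labelling the letters of \<open>v\<close> by \<open>a\<close> piles such that stacking the
  piles, the barred ones turned over, gives \<open>w\<close>. Performing two such inverse shuffles is one inverse
  shuffle whose piles are indexed by pairs of labels, and a pile is turned over iff exactly one of the
  two steps turns it over. Hence the \<open>j\<close>-th power has \<open>a ^ j\<close> piles, and the number of plain minus
  the number of barred piles is \<open>\<epsilon> ^ j\<close> with \<open>\<epsilon> \<in> {0, 1, -1}\<close>. An inverse shuffle that fixes \<open>v\<close> cuts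
  it into plain piles only, so with \<open>p\<close> plain piles the trace is
  \<open>2 ^ n * n! * ((p + n - 1) choose n)\<close>, the product of the factors \<open>2 * p + 2 * i\<close> over \<open>i < n\<close>. With
  \<open>2 * p = a ^ j + \<epsilon> ^ j\<close> these are the power sums of the claimed eigenvalues.\<close>

section \<open>Traces and eigenvalues\<close>

definition mat_trace :: "'a::comm_monoid_add mat \<Rightarrow> 'a" where
  "mat_trace A = (\<Sum>i<dim_row A. A $$ (i, i))"

lemma index_mult_mat_sum:
  assumes "A \<in> carrier_mat n n" "B \<in> carrier_mat n n" "i < n" "j < n"
  shows "(A * B) $$ (i, j) = (\<Sum>k<n. A $$ (i, k) * B $$ (k, j))"
  using assms by (auto simp: scalar_prod_def lessThan_atLeast0 intro!: sum.cong)

lemma mat_trace_mult_commute: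
  fixes A B :: "'a::comm_semiring_0 mat"
  assumes "A \<in> carrier_mat n n" "B \<in> carrier_mat n n"
  shows "mat_trace (A * B) = mat_trace (B * A)"
proof -
  have "mat_trace (A * B) = (\<Sum>i<n. \<Sum>k<n. A $$ (i, k) * B $$ (k, i))"
    using assms by (simp add: mat_trace_def index_mult_mat_sum[of _ n] del: index_mult_mat(1))
  also have "\<dots> = (\<Sum>k<n. \<Sum>i<n. B $$ (k, i) * A $$ (i, k))"
    by (subst sum.swap) (simp add: mult.commute)
  also have "\<dots> = mat_trace (B * A)"
    using assms by (simp add: mat_trace_def index_mult_mat_sum[of _ n] del: index_mult_mat(1))
  finally show ?thesis .
qed

lemma mat_trace_similar:
  assumes "similar_mat_wit A B P Q"
  shows "mat_trace A = (mat_trace B :: 'a::comm_semiring_1)"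
proof -
  define n where "n = dim_row A"
  note D = similar_mat_witD[OF n_def assms]
  have "mat_trace A = mat_trace (P * (B * Q))"
    using D by (simp add: assoc_mult_mat[of _ n n _ n _ n])
  also have "\<dots> = mat_trace (B * Q * P)"
    using D by (intro mat_trace_mult_commute[of _ n]) auto
  also have "B * Q * P = B"
    using D by (simp add: assoc_mult_mat[of _ n n _ n _ n])
  finally show ?thesis .
qed

lemma upper_triangular_pow:
  fixes B :: "'a::semiring_1 mat"
  assumes B: "B \<in> carrier_mat n n" "upper_triangular B"
  shows "upper_triangular (B ^\<^sub>m j)" "i < n \<Longrightarrow> (B ^\<^sub>m j) $$ (i, i) = (B $$ (i, i)) ^ j"
proof -
  have "upper_triangular (B ^\<^sub>m j) \<and> (\<forall>i<n. (B ^\<^sub>m j) $$ (i, i) = (B $$ (i, i)) ^ j)"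
  proof (induction j)
    case 0
    show ?case using B by simp
  next
    case (Suc j)
    have C: "B ^\<^sub>m j \<in> carrier_mat n n" using B by simp
    have entry: "(B ^\<^sub>m Suc j) $$ (i, k) = (\<Sum>l<n. (B ^\<^sub>m j) $$ (i, l) * B $$ (l, k))"
      if "i < n" "k < n" for i k
      using index_mult_mat_sum[OF C B(1) that] by simp
    \<comment> \<open>A summand can be nonzero only for i \<le> l \<le> k. Nothing is left when k <
      i, and only l = i when k = i.\<close>
    have zero: "(B ^\<^sub>m j) $$ (i, l) * B $$ (l, k) = 0" if "i < n" "l < n" "l < i \<or> k < l" for i k l
      using that Suc B C by (auto simp: upper_triangular_def)
    have "(B ^\<^sub>m Suc j) $$ (i, k) = 0" if "i < n" "k < i" for i k
      using that zero[of i _ k] by (subst entry) (auto intro!: sum.neutral zero)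
    moreover have "(B ^\<^sub>m Suc j) $$ (i, i) = B $$ (i, i) ^ Suc j" if "i < n" for i
    proof -
      have "(B ^\<^sub>m Suc j) $$ (i, i) = (\<Sum>l\<in>{i}. (B ^\<^sub>m j) $$ (i, l) * B $$ (l, i))"
        unfolding entry[OF that that]
        by (rule sum.mono_neutral_right) (use that in \<open>auto intro!: zero\<close>)
      thus ?thesis using that Suc by (simp flip: power_Suc2)
    qed
    moreover have "dim_row (B ^\<^sub>m Suc j) = n" using B by simp
    ultimately show ?case by (auto simp: upper_triangular_def)
  qed
  thus "upper_triangular (B ^\<^sub>m j)" "i < n \<Longrightarrow> (B ^\<^sub>m j) $$ (i, i) = (B $$ (i, i)) ^ j" by auto
qed

text \<open>By Schur decomposition \<open>A\<close> is similar to a triangular matrix whose diagonal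
  lists the roots of the characteristic polynomial. Powers act entrywise on that diagonal, and the
  trace is invariant under similarity.\<close>

lemma sum_eigenvalue_mset_power:
  fixes A :: "complex mat"
  assumes A: "A \<in> carrier_mat n n"
  shows "(\<Sum>z\<in>#eigenvalue_mset A. z ^ j) = mat_trace (A ^\<^sub>m j)"
proof -
  obtain es where es: "char_poly A = (\<Prod>a\<leftarrow>es. [:- a, 1:])"
    using char_poly_factorized[OF A] by auto
  obtain B P Q where "schur_decomposition A es = (B, P, Q)"
    by (cases "schur_decomposition A es") auto
  from schur_decomposition[OF A es this]
  have sim: "similar_mat_wit A B P Q" and ut: "upper_triangular B" and diag: "diag_mat B = es"
    by auto
  have B: "B \<in> carrier_mat n n" using similar_mat_witD2[OF A sim] by auto
  have "proots (\<Prod>a\<leftarrow>es. [:- a, 1:]) = mset es"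
  proof (induction es)
    case (Cons a es)
    have "(\<Prod>a\<leftarrow>es. [:- a, 1:]) \<noteq> 0" by (auto simp: prod_list_zero_iff)
    thus ?case using Cons proots_mult[of "[:- a, 1:]" "\<Prod>a\<leftarrow>es. [:- a, 1:]"] by simp
  qed simp
  hence "(\<Sum>z\<in>#eigenvalue_mset A. z ^ j) = (\<Sum>z\<in>#mset (diag_mat B). z ^ j)"
    by (simp add: eigenvalue_mset_def es diag)
  also have "\<dots> = (\<Sum>i<n. (B $$ (i, i)) ^ j)"
    using B by (simp add: diag_mat_def sum_mset_sum_list sum_list_sum_nth lessThan_atLeast0
        flip: mset_map)
  also have "\<dots> = mat_trace (B ^\<^sub>m j)"
    using B upper_triangular_pow(2)[OF B ut] by (simp add: mat_trace_def)
  also have "\<dots> = mat_trace (A ^\<^sub>m j)"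
    by (rule mat_trace_similar[symmetric, OF similar_mat_wit_pow[OF sim]])
  finally show ?thesis .
qed

section \<open>Multisets are determined by their power sums\<close>

lemma sum_mset_poly:
  fixes M :: "'a::comm_ring_1 multiset"
  shows "(\<Sum>z\<in>#M. poly q z) = (\<Sum>j\<le>degree q. coeff q j * (\<Sum>z\<in>#M. z ^ j))"
  by (induction M) (simp_all add: poly_altdef sum.distrib algebra_simps)

lemma sum_mset_conv_sum:
  fixes f :: "'a \<Rightarrow> 'b::comm_semiring_1"
  assumes "finite S" "set_mset M \<subseteq> S"
  shows "(\<Sum>z\<in>#M. f z) = (\<Sum>z\<in>S. of_nat (count M z) * f z)"
  using assms(2)
proof (induction M)
  case (add x M)
  have "(\<Sum>z\<in>S. of_nat (count (add_mset x M) z) * f z)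
      = (\<Sum>z\<in>S. of_nat (count M z) * f z + (if z = x then f z else 0))"
    by (intro sum.cong) (auto simp: algebra_simps)
  thus ?case using add assms(1) by (simp add: sum.distrib add.commute)
qed simp

text \<open>Equal power sums, exponent 0 included, give equal sums of every polynomial. A polynomial
  that vanishes at all other elements of both multisets but not at \<open>z0\<close> isolates the
  multiplicity of \<open>z0\<close>.\<close>

lemma multiset_eqI_power_sums:
  fixes M M' :: "'a::field_char_0 multiset"
  assumes pow: "\<And>j. (\<Sum>z\<in>#M. z ^ j) = (\<Sum>z\<in>#M'. z ^ j)"
  shows "M = M'"
proof (rule multiset_eqI)
  fix z0
  define S where "S = insert z0 (set_mset M \<union> set_mset M')"
  define q where "q = (\<Prod>z\<in>S - {z0}. [:- z, 1:])"
  have S: "finite S" "set_mset M \<subseteq> S" "set_mset M' \<subseteq> S" "z0 \<in> S"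
    by (auto simp: S_def)
  have sumq: "(\<Sum>z\<in>#K. poly q z) = of_nat (count K z0) * poly q z0" if "set_mset K \<subseteq> S" for K
  proof -
    have "(\<Sum>z\<in>#K. poly q z) = (\<Sum>z\<in>S. of_nat (count K z) * poly q z)"
      using S that by (intro sum_mset_conv_sum) auto
    also have "\<dots> = (\<Sum>z\<in>{z0}. of_nat (count K z) * poly q z)"
      using S by (intro sum.mono_neutral_right) (auto simp: q_def poly_prod)
    finally show ?thesis by simp
  qed
  have "(\<Sum>z\<in>#M. poly q z) = (\<Sum>z\<in>#M'. poly q z)"
    by (simp only: sum_mset_poly pow)
  hence "of_nat (count M z0) * poly q z0 = of_nat (count M' z0) * poly q z0"
    using sumq S by simp
  moreover have "poly q z0 \<noteq> 0"
    using S by (auto simp: q_def poly_prod)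
  ultimately show "count M z0 = count M' z0" by simp
qed

section \<open>The operators on basis words\<close>

lemma lookup_basis_vec: "Poly_Mapping.lookup (basis_vec b) c = of_bool (b = c)"
  by (simp add: basis_vec_def lookup_single when_def)

lemma lookup_lin_ext:
  assumes "finite S" "Poly_Mapping.keys x \<subseteq> S"
  shows "Poly_Mapping.lookup (lin_ext f x) c
       = (\<Sum>b\<in>S. Poly_Mapping.lookup x b * Poly_Mapping.lookup (f b) c)"
  unfolding lin_ext_def lookup_sum lookup_scale_vec
  by (rule sum.mono_neutral_left) (use assms in \<open>auto simp: in_keys_iff\<close>)

lemma keys_basis_vec: "Poly_Mapping.keys (basis_vec b) = {b}"
  by (simp add: basis_vec_def)

lemma lin_ext_basis_vec [simp]: "lin_ext f (basis_vec b) = f b"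
  by (rule poly_mapping_eqI) (simp add: lookup_lin_ext[of "{b}"] keys_basis_vec lookup_basis_vec)

lemma lin_ext_sum_basis_vec:
  assumes "finite I"
  shows "lin_ext f (\<Sum>i\<in>I. basis_vec (g i)) = (\<Sum>i\<in>I. f (g i))"
proof (rule poly_mapping_eqI)
  fix c
  have keys: "Poly_Mapping.keys (\<Sum>i\<in>I. basis_vec (g i)) \<subseteq> g ` I"
    using keys_sum[of "\<lambda>i. basis_vec (g i)" I] by (auto simp: keys_basis_vec)
  have "Poly_Mapping.lookup (lin_ext f (\<Sum>i\<in>I. basis_vec (g i))) c
      = (\<Sum>b\<in>g ` I. \<Sum>i\<in>I. of_bool (g i = b) * Poly_Mapping.lookup (f b) c)"
    using assms by (simp add: lookup_lin_ext[OF _ keys] lookup_sum lookup_basis_vec sum_distrib_right)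
  also have "\<dots> = (\<Sum>i\<in>I. \<Sum>b\<in>g ` I. if g i = b then Poly_Mapping.lookup (f b) c else 0)"
    by (subst sum.swap) (auto intro!: sum.cong)
  also have "\<dots> = (\<Sum>i\<in>I. Poly_Mapping.lookup (f (g i)) c)"
    using assms by (intro sum.cong) auto
  finally show "Poly_Mapping.lookup (lin_ext f (\<Sum>i\<in>I. basis_vec (g i))) c
      = Poly_Mapping.lookup (\<Sum>i\<in>I. f (g i)) c"
    by (simp add: lookup_sum)
qed

section \<open>Iterated coproducts of words\<close>

definition splittings :: "nat \<Rightarrow> 'a list \<Rightarrow> 'a list list set" where
  "splittings a w = {us. length us = a \<and> concat us = w}"

text \<open>Empty pieces are allowed, so finiteness rests on the fixed number of pieces; each is at
  most as long as \<open>w\<close> and uses only its letters.\<close>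

lemma finite_splittings: "finite (splittings a w)"
proof (rule finite_subset)
  let ?U = "{u. set u \<subseteq> set w \<and> length u \<le> length w}"
  show "splittings a w \<subseteq> {us. set us \<subseteq> ?U \<and> length us = a}"
    using member_le_sum_list[of _ "map length _"] by (force simp: splittings_def length_concat)
  show "finite {us. set us \<subseteq> ?U \<and> length us = a}"
    by (intro finite_lists_length_eq finite_lists_length_le) simp
qed

text \<open>Each application of \<open>coprod_first\<close> cuts the first piece in two. Gluing the
  first two pieces undoes this, and the length of the first piece recovers the cut, so every
  splitting arises exactly once.\<close>

lemma iter_coprod_basis_vec:
  assumes "a \<ge> 1"
  shows "iter_coprod a (basis_vec w) = (\<Sum>us\<in>splittings a w. basis_vec us)"
proof -
  have "(coprod_first ^^ m) (basis_vec [w]) = (\<Sum>us\<in>splittings (Suc m) w. basis_vec us)" for m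
  proof (induction m)
    case 0
    have "splittings (Suc 0) w = {[w]}"
      by (auto simp: splittings_def length_Suc_conv)
    thus ?case by simp
  next
    case (Suc m)
    let ?g = "\<lambda>(us, i). take i (hd us) # drop i (hd us) # tl us"
    have "(coprod_first ^^ Suc m) (basis_vec [w])
        = (\<Sum>us\<in>splittings (Suc m) w. \<Sum>i\<le>length (hd us). basis_vec (?g (us, i)))"
      unfolding funpow.simps o_apply Suc
      by (simp add: coprod_first_def lin_ext_sum_basis_vec finite_splittings)
    also have "\<dots> = (\<Sum>p\<in>(SIGMA us:splittings (Suc m) w. {..length (hd us)}). basis_vec (?g p))"
      by (subst sum.Sigma) (auto simp: finite_splittings split_def)
    also have "\<dots> = (\<Sum>us\<in>splittings (Suc (Suc m)) w. basis_vec us)"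
      by (rule sum.reindex_bij_witness
          [where i = "\<lambda>us. ((us ! 0 @ us ! 1) # drop 2 us, length (us ! 0))" and j = ?g])
        (auto simp: splittings_def length_Suc_conv)
    finally show ?case .
  qed
  thus ?thesis using assms by (simp add: iter_coprod_def)
qed

section \<open>Coefficients of shuffle products\<close>

lemma count_image_mset_Cons:
  "count (image_mset (\<lambda>w. x # w) M) [] = 0"
  "count (image_mset (\<lambda>w. x # w) M) (z # w) = (if z = x then count M w else 0)"
  by (induction M) auto

text \<open>As \<open>w\<close> has no repeated letter, the positions filled from \<open>u\<close>
  can only be those of the letters of \<open>u\<close>. Hence \<open>w\<close> arises at most once,
  and filtering recovers both factors.\<close>

lemma count_interleavings:
  assumes "distinct w"
  shows "count (interleavings u v) w
       = of_bool (filter (\<lambda>x. x \<in> set u) w = u \<and> filter (\<lambda>x. x \<notin> set u) w = v)"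
  using assms
proof (induction u v arbitrary: w rule: interleavings.induct)
  case (2 x u)
  let ?f = "filter (\<lambda>y. y \<in> set (x # u)) w" and ?g = "filter (\<lambda>y. y \<notin> set (x # u)) w"
  have "?f = x # u \<and> ?g = [] \<longleftrightarrow> w = x # u"
  proof
    assume fg: "?f = x # u \<and> ?g = []"
    hence "?f = w" by (intro filter_True) (auto simp: filter_empty_conv)
    thus "w = x # u" using fg by simp
  next
    assume "w = x # u"
    thus "?f = x # u \<and> ?g = []" by (simp only: filter_id_conv filter_empty_conv) blast
  qed
  hence "count (interleavings (x # u) []) w = of_bool (?f = x # u \<and> ?g = [])"
    by (simp only: interleavings.simps count_single) auto
  thus ?case .
next
  case (3 x u y v)
  show ?case
  proof (cases w)
    case Nil
    thus ?thesis by (simp add: count_image_mset_Cons)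
  next
    case (Cons z w')
    have z: "z \<notin> set w'" "distinct w'" using 3(3) Cons by auto
    have *: "count (interleavings (x # u) (y # v)) w =
        (if z = x then count (interleavings u (y # v)) w' else 0) +
        (if z = y then count (interleavings (x # u) v) w' else 0)"
      by (simp add: Cons count_image_mset_Cons)
    \<comment> \<open>Since \<open>z\<close> does not recur in \<open>w'\<close>, admitting it in a
      filter condition changes nothing on \<open>w'\<close>, and no sublist of \<open>w'\<close>
      contains it. This decides which of the two recursive branches can contribute.\<close>
    have f1: "filter (\<lambda>a. a = z \<or> a \<in> set u) w' = filter (\<lambda>a. a \<in> set u) w'"
             "filter (\<lambda>a. a \<noteq> z \<and> a \<notin> set u) w' = filter (\<lambda>a. a \<notin> set u) w'"
      using z by (auto intro!: filter_cong)
    have f2: "filter P w' \<noteq> z # t" for P t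
      using z(1) filter_is_subset[of P w'] by (metis list.set_intros(1) subsetD)
    have f3: "z \<notin> set u" if "filter P w' = x # u" for P
      using z(1) that filter_is_subset[of P w'] by (metis list.set_intros(2) subsetD)
    show ?thesis unfolding * using z f1 f2 f3
      by (auto simp: Cons "3.IH")
  qed
qed simp

lemma lookup_sum_mset_basis_vec:
  "Poly_Mapping.lookup (\<Sum>w\<in>#M. basis_vec w) v = of_nat (count M v)"
  by (induction M) (auto simp: lookup_add lookup_basis_vec)

lemma lookup_shuffle_prod_basis_vec:
  assumes "distinct w"
  shows "Poly_Mapping.lookup (shuffle_prod (basis_vec u) y) w =
    (if filter (\<lambda>x. x \<in> set u) w = u then Poly_Mapping.lookup y (filter (\<lambda>x. x \<notin> set u) w) else 0)"
proof -
  have "Poly_Mapping.lookup (shuffle_prod (basis_vec u) y) w =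
      (\<Sum>v\<in>Poly_Mapping.keys y. Poly_Mapping.lookup y v * of_nat (count (interleavings u v) w))"
    by (simp add: shuffle_prod_def lookup_lin_ext[of "Poly_Mapping.keys y"] lookup_sum_mset_basis_vec)
  also have "\<dots> = (\<Sum>v\<in>Poly_Mapping.keys y. if filter (\<lambda>x. x \<notin> set u) w = v then
      (if filter (\<lambda>x. x \<in> set u) w = u then Poly_Mapping.lookup y v else 0) else 0)"
    using assms by (intro sum.cong) (auto simp: count_interleavings)
  finally show ?thesis by (auto simp: in_keys_iff)
qed

text \<open>With distinct letters, \<open>v\<close> is a shuffle of the piles \<open>us\<close> in
  at most one way, so the coefficient is 0 or 1. The labelling \<open>f\<close> records the pile of
  each letter, and the induction peels off the first pile.\<close>

lemma lookup_foldr_shuffle_prod: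
  assumes "distinct (map unbar v)"
  shows "Poly_Mapping.lookup (foldr shuffle_prod (map basis_vec us) (basis_vec [])) v =
    of_bool (\<exists>f. (\<forall>x\<in>set v. f (unbar x) < length us) \<and>
                 us = map (\<lambda>l. filter (\<lambda>x. f (unbar x) = l) v) [0..<length us])"
  using assms
proof (induction us arbitrary: v)
  case Nil
  thus ?case by (cases v) (auto simp: lookup_basis_vec)
next
  case (Cons u us)
  define v' where "v' = filter (\<lambda>x. x \<notin> set u) v"
  have v': "distinct (map unbar v')" unfolding v'_def by (rule distinct_map_filter) (rule Cons)
  have dv: "distinct v" and inj: "inj_on unbar (set v)"
    using Cons.prems by (auto simp: distinct_map)
  let ?E = "\<lambda>us v f. (\<forall>x\<in>set v. f (unbar x) < length us) \<and>
      us = map (\<lambda>l. filter (\<lambda>x. f (unbar x) = l) v) [0..<length us]"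
  have "(\<exists>f. ?E (u # us) v f) \<longleftrightarrow> filter (\<lambda>x. x \<in> set u) v = u \<and> (\<exists>f. ?E us v' f)"
  proof (intro iffI conjI; (elim exE conjE)?)
    fix f
    assume bd: "\<forall>x\<in>set v. f (unbar x) < length (u # us)"
      and "u # us = map (\<lambda>l. filter (\<lambda>x. f (unbar x) = l) v) [0..<length (u # us)]"
    hence u: "u = filter (\<lambda>x. f (unbar x) = 0) v"
      and us: "us = map (\<lambda>l. filter (\<lambda>x. f (unbar x) = Suc l) v) [0..<length us]"
      by (auto simp: map_upt_Suc simp del: upt_Suc)
    show "filter (\<lambda>x. x \<in> set u) v = u"
      by (subst (2) u) (auto simp: u intro!: filter_cong)
    have v'_alt: "v' = filter (\<lambda>x. f (unbar x) \<noteq> 0) v"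
      unfolding v'_def by (auto simp: u intro!: filter_cong)
    \<comment> \<open>Labels are nonzero on \<open>v'\<close>, so the truncated subtraction is a
      genuine shift.\<close>
    have "?E us v' (\<lambda>i. f i - 1)"
    proof
      show "\<forall>x\<in>set v'. f (unbar x) - 1 < length us"
        using bd by (auto simp: v'_alt)
      have "filter (\<lambda>x. f (unbar x) - 1 = l) v' = filter (\<lambda>x. f (unbar x) = Suc l) v" for l
        by (auto simp: v'_alt intro!: filter_cong)
      thus "us = map (\<lambda>l. filter (\<lambda>x. f (unbar x) - 1 = l) v') [0..<length us]"
        using us by simp
    qed
    thus "\<exists>f. ?E us v' f" by (intro exI[of _ "\<lambda>i. f i - 1"])
  next
    fix f
    assume u: "filter (\<lambda>x. x \<in> set u) v = u"
      and bd: "\<forall>x\<in>set v'. f (unbar x) < length us"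
      and us: "us = map (\<lambda>l. filter (\<lambda>x. f (unbar x) = l) v') [0..<length us]"
    \<comment> \<open>The new first pile takes label 0 and the others move up by one. Labels live on
      unbarred letters, and injectivity of \<open>unbar\<close> on \<open>v\<close> lets membership
      in \<open>u\<close> be tested there.\<close>
    define g where "g i = (if i \<in> unbar ` set u then 0 else Suc (f i))" for i
    have "set u \<subseteq> set v" using u by (metis filter_is_subset)
    hence mem: "unbar x \<in> unbar ` set u \<longleftrightarrow> x \<in> set u" if "x \<in> set v" for x
      using that inj by (meson inj_on_image_mem_iff)
    have "filter (\<lambda>x. g (unbar x) = 0) v = filter (\<lambda>x. x \<in> set u) v"
      by (intro filter_cong) (simp_all add: g_def mem)
    hence "filter (\<lambda>x. g (unbar x) = 0) v = u" using u by simp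
    moreover have "filter (\<lambda>x. g (unbar x) = Suc l) v = filter (\<lambda>x. f (unbar x) = l) v'" for l
      unfolding v'_def filter_filter by (intro filter_cong) (simp_all add: g_def mem)
    ultimately have "u # us = map (\<lambda>l. filter (\<lambda>x. g (unbar x) = l) v) [0..<length (u # us)]"
      using us by (simp add: map_upt_Suc del: upt_Suc)
    moreover have "\<forall>x\<in>set v. g (unbar x) < length (u # us)"
      using bd by (auto simp: g_def mem v'_def)
    ultimately have "?E (u # us) v g" by (rule conjI[rotated])
    thus "\<exists>f. ?E (u # us) v f" by (intro exI[of _ g])
  qed
  thus ?case
    using Cons.IH[OF v'] lookup_shuffle_prod_basis_vec[OF dv, of u] by (simp add: v'_def)
qed

section \<open>Inverse shuffles\<close>

text \<open>The flag \<open>d\<close> selects the involution, rotation for \<open>False\<close> and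
  flip for \<open>True\<close>, so that both are treated in a single argument.\<close>

definition turn :: "bool \<Rightarrow> word \<Rightarrow> word" where
  "turn d u = (if d then rev (map bar u) else map bar u)"

definition twist :: "bool \<Rightarrow> bool \<Rightarrow> word \<Rightarrow> word" where
  "twist d s u = (if s then turn d u else u)"

lemma turn_eq: "turn False = rot" "turn True = flip"
  by (auto simp: turn_def rot_def flip_def)

lemma bar_bar [simp]: "bar (bar x) = x"
  by (cases x) auto

lemma bar_neq: "bar x \<noteq> x"
  by (cases x) auto

lemma turn_turn [simp]: "turn d (turn d u) = u"
  by (simp add: turn_def rev_map o_def)

text \<open>Turning is an involution for either \<open>d\<close>, so flags compose by exclusive or.
  This is why a pile of a composed shuffle is again either plain or turned over.\<close>

lemma twist_twist [simp]: "twist d s (twist d s' u) = twist d (s \<noteq> s') u"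
  by (simp add: twist_def)

lemma twist_False [simp]: "twist d False u = u"
  by (simp add: twist_def)

lemma unbar_image_twist [simp]: "unbar ` set (twist d s u) = unbar ` set u"
  by (force simp: twist_def turn_def image_iff)

lemma twist_Nil [simp]: "twist d s [] = []"
  by (simp add: twist_def turn_def)

lemma letter_content_twist [simp]: "letter_content (twist d s u) = letter_content u"
  by (simp add: twist_def turn_def letter_content_def image_mset.compositionality o_def)

lemma filter_twist:
  "filter (\<lambda>x. P (unbar x)) (twist d s u) = twist d s (filter (\<lambda>x. P (unbar x)) u)"
  by (simp add: twist_def turn_def filter_map o_def flip: rev_filter)

text \<open>A pattern \<open>\<sigma>\<close> lists the piles with their labels, \<open>True\<close> marking the barred ones. Labels are
  attached to the unbarred letters, so that turning a pile over does not affect them.\<close>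

definition inv_shuffle :: "bool \<Rightarrow> ('l \<times> bool) list \<Rightarrow> (nat \<Rightarrow> 'l) \<Rightarrow> word \<Rightarrow> word" where
  "inv_shuffle d \<sigma> f v = concat (map (\<lambda>(l, s). twist d s (filter (\<lambda>x. f (unbar x) = l) v)) \<sigma>)"

text \<open>Common form of the four operators: \<open>s j\<close> tells whether factor
  \<open>j\<close> is turned. Factors are numbered from 0, so the plus operators have
  \<open>s = odd\<close> and the minus operators \<open>s = even\<close>.\<close>

definition alt_op :: "bool \<Rightarrow> (nat \<Rightarrow> bool) \<Rightarrow> nat \<Rightarrow> word freevec \<Rightarrow> word freevec" where
  "alt_op d s a x = iter_prod (lin_ext (\<lambda>ws. basis_vec
     (map (\<lambda>j. twist d (s j) (ws ! j)) [0..<length ws])) (iter_coprod a x))"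

lemma theta_eq_alt_op:
  "theta_plus (turn d) a = alt_op d odd a" "theta_minus (turn d) a = alt_op d even a"
  by (auto simp: fun_eq_iff theta_plus_def theta_minus_def alt_plus_def alt_minus_def alt_op_def
      twist_def intro!: arg_cong[of _ _ iter_prod] arg_cong[of _ _ basis_vec]
        arg_cong2[of _ _ _ _ lin_ext])

text \<open>Labellings are taken extensional on the unbarred letters of \<open>v\<close>, so that
  two of them differ only if they differ on a letter of \<open>v\<close>.\<close>

definition inv_shuffle_count :: "bool \<Rightarrow> ('l \<times> bool) list \<Rightarrow> word \<Rightarrow> word \<Rightarrow> nat" where
  "inv_shuffle_count d \<sigma> v w =
     card {f \<in> unbar ` set v \<rightarrow>\<^sub>E fst ` set \<sigma>. inv_shuffle d \<sigma> f v = w}"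

text \<open>The coefficient counts the cuts of \<open>w\<close> whose pieces, after turning, shuffle
  to \<open>v\<close>. Such a cut corresponds to one labelling of \<open>v\<close>: collecting the
  letters of each label and turning the piles back recovers the pieces.\<close>

lemma lookup_alt_op:
  assumes "a \<ge> 1" and v: "distinct (map unbar v)"
  shows "Poly_Mapping.lookup (alt_op d s a (basis_vec w)) v =
    of_nat (inv_shuffle_count d (map (\<lambda>l. (l, s l)) [0..<a]) v w)"
proof -
  let ?tw = "\<lambda>us. map (\<lambda>j. twist d (s j) (us ! j)) [0..<a]"
  let ?bl = "\<lambda>f. map (\<lambda>l. filter (\<lambda>x. f (unbar x) = l) v) [0..<a]"
  let ?E = "\<lambda>us. \<exists>f. (\<forall>x\<in>set v. f (unbar x) < a) \<and> ?tw us = ?bl f"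
  let ?G = "\<lambda>f. map (\<lambda>l. twist d (s l) (filter (\<lambda>x. f (unbar x) = l) v)) [0..<a]"
  let ?\<sigma> = "map (\<lambda>l. (l, s l)) [0..<a]"
  let ?F = "{f \<in> unbar ` set v \<rightarrow>\<^sub>E fst ` set ?\<sigma>. inv_shuffle d ?\<sigma> f v = w}"
  have shuf: "inv_shuffle d ?\<sigma> f v = concat (?G f)" for f
    by (simp add: inv_shuffle_def o_def)
  have "Poly_Mapping.lookup (alt_op d s a (basis_vec w)) v =
      (\<Sum>us\<in>splittings a w. Poly_Mapping.lookup
         (foldr shuffle_prod (map basis_vec (map (\<lambda>j. twist d (s j) (us ! j)) [0..<length us])) (basis_vec [])) v)"
    by (simp add: alt_op_def iter_coprod_basis_vec[OF assms(1)] lin_ext_sum_basis_vec finite_splittings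
        iter_prod_def lookup_sum)
  also have "\<dots> = (\<Sum>us\<in>splittings a w. of_bool (?E us))"
    unfolding lookup_foldr_shuffle_prod[OF v]
    by (intro sum.cong) (auto simp: splittings_def)
  also have "\<dots> = of_nat (card {us \<in> splittings a w. ?E us})"
    by (simp add: of_bool_def sum.If_cases finite_splittings Int_def)
  also have "card {us \<in> splittings a w. ?E us} = card ?F"
  proof (rule bij_betw_same_card[symmetric, of ?G], rule bij_betw_imageI)
    show "inj_on ?G ?F"
    proof (rule inj_onI)
      fix f g assume f: "f \<in> ?F" and g: "g \<in> ?F" and eq: "?G f = ?G g"
      show "f = g"
      proof (rule PiE_ext)
        show "f \<in> unbar ` set v \<rightarrow>\<^sub>E fst ` set ?\<sigma>" "g \<in> unbar ` set v \<rightarrow>\<^sub>E fst ` set ?\<sigma>"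
          using f g by auto
        fix i assume i: "i \<in> unbar ` set v"
        \<comment> \<open>Pile number \<open>f i\<close> contains the letter \<open>i\<close> up to
          a bar, so the list of piles determines the label of \<open>i\<close>.\<close>
        have l: "f i < a" using f i by (auto simp: PiE_def Pi_def)
        hence "twist d (s (f i)) (filter (\<lambda>x. f (unbar x) = f i) v)
             = twist d (s (f i)) (filter (\<lambda>x. g (unbar x) = f i) v)"
          using arg_cong[OF eq, of "\<lambda>xs. xs ! f i"] by simp
        hence "unbar ` set (filter (\<lambda>x. f (unbar x) = f i) v)
             = unbar ` set (filter (\<lambda>x. g (unbar x) = f i) v)"
          by (metis unbar_image_twist)
        moreover have "i \<in> unbar ` set (filter (\<lambda>x. f (unbar x) = f i) v)"
          using i by auto
        ultimately show "f i = g i" by auto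
      qed
    qed
    show "?G ` ?F = {us \<in> splittings a w. ?E us}"
    proof (intro equalityI subsetI)
      fix us assume "us \<in> ?G ` ?F"
      then obtain f where f: "f \<in> ?F" "us = ?G f" by blast
      have "?tw us = ?bl f" by (simp add: f(2))
      moreover have "\<forall>x\<in>set v. f (unbar x) < a" using f(1) by (auto simp: PiE_def Pi_def)
      moreover have "us \<in> splittings a w" using f shuf by (simp add: splittings_def)
      ultimately show "us \<in> {us \<in> splittings a w. ?E us}" by blast
    next
      fix us assume us: "us \<in> {us \<in> splittings a w. ?E us}"
      then obtain f where f: "\<forall>x\<in>set v. f (unbar x) < a" "?tw us = ?bl f" by blast
      have len: "length us = a" "concat us = w" using us by (auto simp: splittings_def)
      define g where "g = restrict f (unbar ` set v)"
      have bl: "filter (\<lambda>x. g (unbar x) = l) v = filter (\<lambda>x. f (unbar x) = l) v" for l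
        by (auto simp: g_def intro!: filter_cong)
      have "us = ?G g"
      proof (rule nth_equalityI)
        fix j assume j: "j < length us"
        hence "twist d (s j) (us ! j) = filter (\<lambda>x. f (unbar x) = j) v"
          using arg_cong[OF f(2), of "\<lambda>xs. xs ! j"] len by simp
        hence "twist d (s j) (twist d (s j) (us ! j)) = twist d (s j) (filter (\<lambda>x. f (unbar x) = j) v)"
          by simp
        thus "us ! j = ?G g ! j" using j len by (simp add: bl)
      qed (simp add: len)
      moreover have "g \<in> ?F"
        using f(1) len calculation shuf[of g] by (auto simp: g_def image_image)
      ultimately show "us \<in> ?G ` ?F" by blast
    qed
  qed
  finally show ?thesis by (simp add: inv_shuffle_count_def)
qed

section \<open>Letter content and composition of inverse shuffles\<close>

lemma inv_shuffle_cong: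
  assumes "\<And>x. x \<in> set v \<Longrightarrow> f (unbar x) = g (unbar x)"
  shows "inv_shuffle d \<sigma> f v = inv_shuffle d \<sigma> g v"
proof -
  have "filter (\<lambda>x. f (unbar x) = l) v = filter (\<lambda>x. g (unbar x) = l) v" for l
    using assms by (intro filter_cong) auto
  thus ?thesis by (simp add: inv_shuffle_def)
qed

lemma inv_shuffle_Cons_pattern:
  "inv_shuffle d ((l, s) # \<sigma>) f v = twist d s (filter (\<lambda>x. f (unbar x) = l) v) @ inv_shuffle d \<sigma> f v"
  by (simp add: inv_shuffle_def)

lemma inv_shuffle_append_pattern:
  "inv_shuffle d (\<sigma> @ \<sigma>') f v = inv_shuffle d \<sigma> f v @ inv_shuffle d \<sigma>' f v"
  by (simp add: inv_shuffle_def)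

lemma letter_content_append [simp]: "letter_content (u @ v) = letter_content u + letter_content v"
  by (simp add: letter_content_def)

lemma letter_content_filter_disj:
  assumes "\<And>x. x \<in> set v \<Longrightarrow> \<not> (P x \<and> Q x)"
  shows "letter_content (filter P v) + letter_content (filter Q v)
       = letter_content (filter (\<lambda>x. P x \<or> Q x) v)"
  using assms by (induction v) (auto simp: letter_content_def)

text \<open>Letters whose label is missing from the pattern are dropped, which lets the induction
  remove one pile at a time. Distinct labels keep the piles disjoint.\<close>

lemma letter_content_inv_shuffle_aux:
  assumes "distinct (map fst \<sigma>)"
  shows "letter_content (inv_shuffle d \<sigma> f v) = letter_content (filter (\<lambda>x. f (unbar x) \<in> fst ` set \<sigma>) v)"
  using assms
proof (induction \<sigma>)
  case Nil
  thus ?case by (simp add: inv_shuffle_def)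
next
  case (Cons p \<sigma>)
  obtain l s where p: "p = (l, s)" by (cases p)
  show ?case using Cons
    by (simp add: p inv_shuffle_Cons_pattern letter_content_filter_disj)
qed

lemma letter_content_inv_shuffle:
  assumes "distinct (map fst \<sigma>)" "\<And>x. x \<in> set v \<Longrightarrow> f (unbar x) \<in> fst ` set \<sigma>"
  shows "letter_content (inv_shuffle d \<sigma> f v) = letter_content v"
proof -
  have "filter (\<lambda>x. f (unbar x) \<in> fst ` set \<sigma>) v = v"
    using assms(2) by (intro filter_True) auto
  thus ?thesis using letter_content_inv_shuffle_aux[OF assms(1), of d f v] by simp
qed

text \<open>Labels of the second step come first, as its piles are the outer ones. Turning over a pile
  reverses the order of the piles inside it for flips (\<open>d = True\<close>) but not for rotations.\<close>

definition comp_pattern ::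
    "bool \<Rightarrow> ('k \<times> bool) list \<Rightarrow> ('k list \<times> bool) list \<Rightarrow> ('k list \<times> bool) list" where
  "comp_pattern d \<tau> \<sigma> = concat (map (\<lambda>(k, t).
     map (\<lambda>(l, s). (k # l, t \<noteq> s)) (if d \<and> t then rev \<sigma> else \<sigma>)) \<tau>)"

lemma comp_pattern_simps:
  "comp_pattern d [] \<sigma> = []"
  "comp_pattern d ((k, t) # \<tau>) \<sigma> =
     map (\<lambda>(l, s). (k # l, t \<noteq> s)) (if d \<and> t then rev \<sigma> else \<sigma>) @ comp_pattern d \<tau> \<sigma>"
  by (simp_all add: comp_pattern_def)

lemma twist_concat:
  "twist d t (concat us) = concat (map (twist d t) (if d \<and> t then rev us else us))"
  by (auto simp: twist_def[abs_def] turn_def[abs_def] map_concat rev_concat rev_map o_def)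

text \<open>A pile of the second step collects, from each pile of the first, the letters carrying
  both labels. A pair of labels is stored as \<open>k # l\<close>, so that iterates of any order
  have labels in one list type.\<close>

lemma inv_shuffle_inv_shuffle:
  "inv_shuffle d \<tau> g (inv_shuffle d \<sigma> f v) = inv_shuffle d (comp_pattern d \<tau> \<sigma>) (\<lambda>i. g i # f i) v"
proof -
  have block: "twist d t (filter (\<lambda>x. g (unbar x) = k) (inv_shuffle d \<sigma> f v)) =
      inv_shuffle d (map (\<lambda>(l, s). (k # l, t \<noteq> s)) (if d \<and> t then rev \<sigma> else \<sigma>)) (\<lambda>i. g i # f i) v"
    for k t
  proof -
    \<comment> \<open>Labels depend only on unbarred letters, so selecting by \<open>g\<close> can
      be done inside each pile before it is turned.\<close>
    have "filter (\<lambda>x. g (unbar x) = k) (inv_shuffle d \<sigma> f v) =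
        concat (map (\<lambda>(l, s). twist d s (filter (\<lambda>x. g (unbar x) # f (unbar x) = k # l) v)) \<sigma>)"
      by (auto simp: inv_shuffle_def filter_concat filter_twist[where P = "\<lambda>i. g i = k"] o_def split_def
          conj_commute intro!: arg_cong[of _ _ concat])
    thus ?thesis by (simp add: inv_shuffle_def twist_concat rev_map o_def split_def)
  qed
  show ?thesis
  proof (induction \<tau>)
    case Nil
    show ?case by (simp add: inv_shuffle_def comp_pattern_simps)
  next
    case (Cons p \<tau>)
    thus ?case
      by (cases p) (simp only: inv_shuffle_Cons_pattern comp_pattern_simps inv_shuffle_append_pattern block)
  qed
qed

lemma fst_comp_pattern:
  "fst ` set (comp_pattern d \<tau> \<sigma>) = (\<lambda>(k, l). k # l) ` (fst ` set \<tau> \<times> fst ` set \<sigma>)"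
proof (induction \<tau>)
  case Nil
  show ?case by (simp add: comp_pattern_simps)
next
  case (Cons p \<tau>)
  obtain k t where p: "p = (k, t)" by (cases p)
  have block: "fst ` set (map (\<lambda>(l, s). (k # l, t \<noteq> s)) (if d \<and> t then rev \<sigma> else \<sigma>)) = (#) k ` fst ` set \<sigma>"
    by (simp add: image_image split_def)
  have insert: "(\<lambda>(k, l). k # l) ` (insert k K \<times> L) = (#) k ` L \<union> (\<lambda>(k, l). k # l) ` (K \<times> L)"
    for K :: "'a set" and L
    by auto
  show ?case
    unfolding p comp_pattern_simps set_append image_Un block Cons list.set image_insert fst_conv insert ..
qed

lemma distinct_comp_pattern:
  assumes "distinct (map fst \<tau>)" "distinct (map fst \<sigma>)"
  shows "distinct (map fst (comp_pattern d \<tau> \<sigma>))"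
  using assms(1)
proof (induction \<tau>)
  case Nil
  thus ?case by (simp add: comp_pattern_def)
next
  case (Cons p \<tau>)
  obtain k t where p: "p = (k, t)" by (cases p)
  note comp_pattern_simps(2)[of d k t \<tau> \<sigma>, folded p]
  moreover have "distinct (map fst (map (\<lambda>(l, s). (k # l, t \<noteq> s)) (if d \<and> t then rev \<sigma> else \<sigma>)))"
    using assms(2) by (auto simp: o_def split_def distinct_map inj_on_def)
  moreover have "k # l \<notin> fst ` set (comp_pattern d \<tau> \<sigma>)" for l
    using Cons.prems by (auto simp: fst_comp_pattern p)
  ultimately show ?case using Cons by (auto simp: image_iff) (metis fst_conv)+
qed

section \<open>Numbers of plain and barred piles\<close>

definition n_plain :: "('l \<times> bool) list \<Rightarrow> nat" where
  "n_plain \<sigma> = length (filter (\<lambda>p. \<not> snd p) \<sigma>)"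

definition n_barred :: "('l \<times> bool) list \<Rightarrow> nat" where
  "n_barred \<sigma> = length (filter snd \<sigma>)"

text \<open>A composed pile is plain iff the two flags agree, so the pair of counts multiplies as in
  the group ring of Z/2. Reversing the order of piles does not affect it.\<close>

lemma n_plain_barred_comp_pattern:
  "n_plain (comp_pattern d \<tau> \<sigma>) = n_plain \<tau> * n_plain \<sigma> + n_barred \<tau> * n_barred \<sigma>"
  "n_barred (comp_pattern d \<tau> \<sigma>) = n_plain \<tau> * n_barred \<sigma> + n_barred \<tau> * n_plain \<sigma>"
proof -
  let ?m = "\<lambda>k t. map (\<lambda>(l, s). (k # l, t \<noteq> s)) (if d \<and> t then rev \<sigma> else \<sigma>)"
  have m: "n_plain (?m k t) = (if t then n_barred \<sigma> else n_plain \<sigma>)"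
       "n_barred (?m k t) = (if t then n_plain \<sigma> else n_barred \<sigma>)" for k t
    by (cases t; cases d; simp add: n_plain_def n_barred_def filter_map o_def split_def flip: rev_filter)+
  have app: "n_plain (\<rho> @ \<rho>') = n_plain \<rho> + n_plain \<rho>'" "n_barred (\<rho> @ \<rho>') = n_barred \<rho> + n_barred \<rho>'"
    for \<rho> \<rho>' :: "('x \<times> bool) list"
    by (simp_all add: n_plain_def n_barred_def)
  have cons: "n_plain ((k, t) # \<tau>) = (if t then 0 else 1) + n_plain \<tau>"
    "n_barred ((k, t) # \<tau>) = (if t then 1 else 0) + n_barred \<tau>" for k t and \<tau> :: "('a \<times> bool) list"
    by (simp_all add: n_plain_def n_barred_def)
  show "n_plain (comp_pattern d \<tau> \<sigma>) = n_plain \<tau> * n_plain \<sigma> + n_barred \<tau> * n_barred \<sigma>"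
  proof (induction \<tau>)
    case (Cons p \<tau>)
    thus ?case by (cases p) (simp only: comp_pattern_simps app m cons; simp)
  qed (simp add: comp_pattern_simps n_plain_def n_barred_def)
  show "n_barred (comp_pattern d \<tau> \<sigma>) = n_plain \<tau> * n_barred \<sigma> + n_barred \<tau> * n_plain \<sigma>"
  proof (induction \<tau>)
    case (Cons p \<tau>)
    thus ?case by (cases p) (simp only: comp_pattern_simps app m cons; simp)
  qed (simp add: comp_pattern_simps n_plain_def n_barred_def)
qed

text \<open>The zeroth pattern is a single plain pile with the empty label: its only labelling
  leaves every word fixed.\<close>

fun pow_pattern :: "bool \<Rightarrow> ('k \<times> bool) list \<Rightarrow> nat \<Rightarrow> ('k list \<times> bool) list" where
  "pow_pattern d \<tau> 0 = [([], False)]"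
| "pow_pattern d \<tau> (Suc j) = comp_pattern d \<tau> (pow_pattern d \<tau> j)"

lemma distinct_pow_pattern:
  "distinct (map fst \<tau>) \<Longrightarrow> distinct (map fst (pow_pattern d \<tau> j))"
  by (induction j) (auto intro: distinct_comp_pattern)

text \<open>Sum and difference of the two counts come from the two characters of Z/2, so both are
  multiplicative under \<open>comp_pattern\<close>. Adding them isolates the plain piles.\<close>

lemma n_plain_pow_pattern:
  "2 * int (n_plain (pow_pattern d \<tau> j)) = int (length \<tau>) ^ j + (int (n_plain \<tau>) - int (n_barred \<tau>)) ^ j"
proof -
  let ?p = "\<lambda>j. int (n_plain (pow_pattern d \<tau> j))" and ?b = "\<lambda>j. int (n_barred (pow_pattern d \<tau> j))"
  have len: "int (length \<tau>) = int (n_plain \<tau>) + int (n_barred \<tau>)"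
    using sum_length_filter_compl[of snd \<tau>] by (simp add: n_plain_def n_barred_def)
  have "?p j + ?b j = int (length \<tau>) ^ j \<and> ?p j - ?b j = (int (n_plain \<tau>) - int (n_barred \<tau>)) ^ j"
  proof (induction j)
    case 0
    show ?case by (simp add: n_plain_def n_barred_def)
  next
    case (Suc j)
    have "?p (Suc j) + ?b (Suc j) = (int (n_plain \<tau>) + int (n_barred \<tau>)) * (?p j + ?b j)"
      "?p (Suc j) - ?b (Suc j) = (int (n_plain \<tau>) - int (n_barred \<tau>)) * (?p j - ?b j)"
      by (simp_all add: n_plain_barred_comp_pattern algebra_simps)
    thus ?case using Suc len by simp
  qed
  thus ?thesis by simp
qed

section \<open>Products of shuffle counts\<close>

lemma unbar_image_letter_content: "unbar ` set v = set_mset (letter_content v)"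
  by (simp add: letter_content_def)

text \<open>An intermediate word with labellings for both steps amounts to one labelling by pairs,
  since the first labelling already determines that word. Inverse shuffling preserves letter
  content, so the word lies in the range of the sum.\<close>

lemma sum_inv_shuffle_count_mult:
  assumes \<tau>: "distinct (map fst \<tau>)" and \<sigma>: "distinct (map fst \<sigma>)"
    and fin: "finite {u. letter_content u = letter_content v}"
  shows "(\<Sum>u | letter_content u = letter_content v. inv_shuffle_count d \<sigma> v u * inv_shuffle_count d \<tau> u w)
       = inv_shuffle_count d (comp_pattern d \<tau> \<sigma>) v w"
proof -
  define S where "S = {u. letter_content u = letter_content v}"
  define D where "D = unbar ` set v"
  define K where "K = fst ` set \<tau>"
  define L where "L = fst ` set \<sigma>"
  let ?\<rho> = "comp_pattern d \<tau> \<sigma>"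
  let ?F = "\<lambda>u. {f \<in> D \<rightarrow>\<^sub>E L. inv_shuffle d \<sigma> f v = u}"
  let ?G = "\<lambda>u. {g \<in> D \<rightarrow>\<^sub>E K. inv_shuffle d \<tau> g u = w}"
  let ?H = "{h \<in> D \<rightarrow>\<^sub>E fst ` set ?\<rho>. inv_shuffle d ?\<rho> h v = w}"
  have finF: "finite (?F u)" "finite (?G u)" for u
    by (rule finite_subset[of _ "D \<rightarrow>\<^sub>E L"] finite_subset[of _ "D \<rightarrow>\<^sub>E K"];
        auto simp: D_def K_def L_def intro!: finite_PiE)+
  have comp: "inv_shuffle d ?\<rho> h v = inv_shuffle d \<tau> g (inv_shuffle d \<sigma> f v)"
    if "\<And>i. i \<in> D \<Longrightarrow> h i = g i # f i" for f g h
    unfolding inv_shuffle_inv_shuffle by (rule inv_shuffle_cong) (use that in \<open>auto simp: D_def\<close>)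
  have inS: "inv_shuffle d \<sigma> f v \<in> S" if "f \<in> D \<rightarrow>\<^sub>E L" for f
    unfolding S_def mem_Collect_eq using that \<sigma>
    by (intro letter_content_inv_shuffle) (auto simp: D_def L_def)
  \<comment> \<open>All words in \<open>S\<close> have the unbarred letters of \<open>v\<close>, so
    both labellings share the domain \<open>D\<close>.\<close>
  have "(\<Sum>u\<in>S. inv_shuffle_count d \<sigma> v u * inv_shuffle_count d \<tau> u w) = (\<Sum>u\<in>S. card (?F u \<times> ?G u))"
    by (intro sum.cong)
      (auto simp: inv_shuffle_count_def S_def D_def K_def L_def unbar_image_letter_content card_cartesian_product)
  also have "\<dots> = card (SIGMA u:S. ?F u \<times> ?G u)"
    using fin finF by (subst card_SigmaI) (auto simp: S_def)
  also have "\<dots> = card ?H"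
  proof (rule bij_betw_same_card, rule bij_betw_byWitness)
    let ?j = "\<lambda>(u, f, g). \<lambda>i\<in>D. g i # f i"
    let ?i = "\<lambda>h. (inv_shuffle d \<sigma> (\<lambda>i\<in>D. tl (h i)) v, \<lambda>i\<in>D. tl (h i), \<lambda>i\<in>D. hd (h i))"
    show "\<forall>p\<in>(SIGMA u:S. ?F u \<times> ?G u). ?i (?j p) = p"
    proof
      fix p assume "p \<in> (SIGMA u:S. ?F u \<times> ?G u)"
      then obtain u f g where p: "p = (u, f, g)" "f \<in> ?F u" "g \<in> ?G u" by auto
      have "(\<lambda>i\<in>D. tl ((\<lambda>i\<in>D. g i # f i) i)) = f" "(\<lambda>i\<in>D. hd ((\<lambda>i\<in>D. g i # f i) i)) = g"
        using p by (auto simp: PiE_def extensional_def restrict_def fun_eq_iff)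
      thus "?i (?j p) = p" using p by simp
    qed
    \<comment> \<open>The labels of \<open>?\<rho>\<close> are nonempty lists, so \<open>hd\<close>
      and \<open>tl\<close> split them into their two components.\<close>
    have hdtl: "hd (h i) # tl (h i) = h i" "hd (h i) \<in> K" "tl (h i) \<in> L"
      if "h \<in> D \<rightarrow>\<^sub>E fst ` set ?\<rho>" "i \<in> D" for h i
      using PiE_mem[OF that] unfolding fst_comp_pattern K_def[symmetric] L_def[symmetric] by auto
    show "\<forall>h\<in>?H. ?j (?i h) = h"
    proof
      fix h assume h: "h \<in> ?H"
      show "?j (?i h) = h"
      proof
        fix i
        show "?j (?i h) i = h i"
          using h hdtl(1)[of h i] by (cases "i \<in> D") (auto simp: PiE_iff extensional_def)
      qed
    qed
    show "?j ` (SIGMA u:S. ?F u \<times> ?G u) \<subseteq> ?H"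
    proof
      fix h assume "h \<in> ?j ` (SIGMA u:S. ?F u \<times> ?G u)"
      then obtain u f g where p: "h = (\<lambda>i\<in>D. g i # f i)" "f \<in> ?F u" "g \<in> ?G u" by auto
      have "inv_shuffle d ?\<rho> h v = w"
        using p comp[of h g f] by simp
      moreover have "h \<in> D \<rightarrow>\<^sub>E fst ` set ?\<rho>"
        using p by (auto simp: fst_comp_pattern K_def[symmetric] L_def[symmetric])
      ultimately show "h \<in> ?H" by simp
    qed
    show "?i ` ?H \<subseteq> (SIGMA u:S. ?F u \<times> ?G u)"
    proof
      fix p assume "p \<in> ?i ` ?H"
      then obtain h where h: "h \<in> ?H" "p = ?i h" by blast
      let ?f = "\<lambda>i\<in>D. tl (h i)" and ?g = "\<lambda>i\<in>D. hd (h i)"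
      have f: "?f \<in> D \<rightarrow>\<^sub>E L" and g: "?g \<in> D \<rightarrow>\<^sub>E K"
        by (intro PiE_I; use h in \<open>simp add: hdtl\<close>)+
      moreover have "inv_shuffle d \<tau> ?g (inv_shuffle d \<sigma> ?f v) = w"
      proof -
        have "inv_shuffle d ?\<rho> h v = inv_shuffle d \<tau> ?g (inv_shuffle d \<sigma> ?f v)"
          by (rule comp) (use h in \<open>simp add: hdtl(1)\<close>)
        thus ?thesis using h by simp
      qed
      ultimately show "p \<in> (SIGMA u:S. ?F u \<times> ?G u)"
        using inS[OF f] h(2) by simp
    qed
  qed
  finally show ?thesis by (simp add: S_def D_def inv_shuffle_count_def)
qed

section \<open>Labellings that fix a word\<close>

definition fixed_labellings :: "bool \<Rightarrow> ('l \<times> bool) list \<Rightarrow> word \<Rightarrow> (nat \<Rightarrow> 'l) set" where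
  "fixed_labellings d \<sigma> v = {f \<in> unbar ` set v \<rightarrow>\<^sub>E fst ` set \<sigma>. inv_shuffle d \<sigma> f v = v}"

lemma finite_fixed_labellings: "finite (fixed_labellings d \<sigma> v)"
  unfolding fixed_labellings_def
  by (rule finite_subset[of _ "unbar ` set v \<rightarrow>\<^sub>E fst ` set \<sigma>"]) (auto intro!: finite_PiE)

text \<open>An empty pile contributes nothing to the stack and can be deleted from the
  pattern.\<close>

lemma fixed_labellings_avoiding:
  assumes "l \<notin> fst ` set \<sigma>"
  shows "{f \<in> fixed_labellings d ((l, s) # \<sigma>) v. \<forall>x\<in>set v. f (unbar x) \<noteq> l} = fixed_labellings d \<sigma> v"
proof (intro equalityI subsetI)
  fix f assume f: "f \<in> {f \<in> fixed_labellings d ((l, s) # \<sigma>) v. \<forall>x\<in>set v. f (unbar x) \<noteq> l}"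
  hence "filter (\<lambda>x. f (unbar x) = l) v = []" by (auto simp: filter_empty_conv)
  moreover have "f \<in> unbar ` set v \<rightarrow>\<^sub>E fst ` set \<sigma>"
  proof (rule PiE_I)
    fix i assume "i \<in> unbar ` set v"
    hence "f i \<in> insert l (fst ` set \<sigma>)" "f i \<noteq> l"
      using f by (auto simp: fixed_labellings_def simp del: image_iff dest: PiE_mem)
    thus "f i \<in> fst ` set \<sigma>" by simp
  qed (use f in \<open>simp add: fixed_labellings_def PiE_iff extensional_def\<close>)
  ultimately show "f \<in> fixed_labellings d \<sigma> v"
    using f by (simp add: fixed_labellings_def inv_shuffle_Cons_pattern)
next
  fix f assume f: "f \<in> fixed_labellings d \<sigma> v"
  have ne: "f (unbar x) \<noteq> l" if "x \<in> set v" for x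
  proof -
    have "f (unbar x) \<in> fst ` set \<sigma>" using that f by (simp add: fixed_labellings_def PiE_iff)
    thus ?thesis using assms by metis
  qed
  hence "filter (\<lambda>x. f (unbar x) = l) v = []" by (auto simp: filter_empty_conv)
  thus "f \<in> {f \<in> fixed_labellings d ((l, s) # \<sigma>) v. \<forall>x\<in>set v. f (unbar x) \<noteq> l}"
    using f ne by (simp add: fixed_labellings_def inv_shuffle_Cons_pattern PiE_iff)
qed

text \<open>A letter x in a turned pile puts \<open>bar x\<close> into the output. As the unbarred
  letters of \<open>v\<close> are distinct, \<open>v\<close> cannot contain both, so the barred pile
  is empty.\<close>

lemma fixed_labellings_barred:
  assumes "l \<notin> fst ` set \<sigma>" and v: "distinct (map unbar v)"
  shows "fixed_labellings d ((l, True) # \<sigma>) v = fixed_labellings d \<sigma> v"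
proof -
  have "f (unbar x) \<noteq> l" if f: "f \<in> fixed_labellings d ((l, True) # \<sigma>) v" and x: "x \<in> set v" for f x
  proof
    assume "f (unbar x) = l"
    hence "bar x \<in> set (twist d True (filter (\<lambda>x. f (unbar x) = l) v))"
      using x by (auto simp: twist_def turn_def)
    hence "bar x \<in> set (inv_shuffle d ((l, True) # \<sigma>) f v)"
      by (simp add: inv_shuffle_Cons_pattern)
    hence "bar x \<in> set v" using f by (simp add: fixed_labellings_def)
    hence "bar x = x" using inj_onD[of unbar "set v" "bar x" x] x v by (simp add: distinct_map)
    thus False using bar_neq by blast
  qed
  thus ?thesis using fixed_labellings_avoiding[OF assms(1), of d True v] by blast
qed

lemma inv_shuffle_Nil [simp]: "inv_shuffle d \<sigma> f [] = []"
  by (auto simp: inv_shuffle_def)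

lemma inv_shuffle_Cons_skip:
  assumes "f (unbar x) \<notin> fst ` set \<sigma>"
  shows "inv_shuffle d \<sigma> f (x # v) = inv_shuffle d \<sigma> f v"
proof -
  have "filter (\<lambda>y. f (unbar y) = fst p) (x # v) = filter (\<lambda>y. f (unbar y) = fst p) v"
    if "p \<in> set \<sigma>" for p
    using assms that by auto
  thus ?thesis unfolding inv_shuffle_def split_def
    by (intro arg_cong[of _ _ concat] map_cong) simp_all
qed

text \<open>If the first pile contains \<open>x\<close>, deleting \<open>x\<close> leaves a fixed
  labelling of \<open>v\<close>. Otherwise that pile must be empty, because its first letter would
  head the output in place of \<open>x\<close>. This is a Pascal recurrence.\<close>

lemma card_fixed_labellings_plain_Cons:
  assumes l: "l \<notin> fst ` set \<sigma>" and v: "distinct (map unbar (x # v))"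
  shows "card (fixed_labellings d ((l, False) # \<sigma>) (x # v))
       = card (fixed_labellings d ((l, False) # \<sigma>) v) + card (fixed_labellings d \<sigma> (x # v))"
proof -
  let ?\<sigma> = "(l, False) # \<sigma>"
  let ?F = "fixed_labellings d ?\<sigma> (x # v)"
  define A where "A = {f \<in> ?F. f (unbar x) = l}"
  define B where "B = {f \<in> ?F. \<forall>y\<in>set (x # v). f (unbar y) \<noteq> l}"
  have x: "unbar x \<notin> unbar ` set v" using v by auto
  have hit: "inv_shuffle d ?\<sigma> f (x # v) = x # inv_shuffle d ?\<sigma> f v" if "f (unbar x) = l" for f
    using that l by (simp add: inv_shuffle_Cons_pattern inv_shuffle_Cons_skip)
  have miss: "f (unbar y) \<noteq> l" if f: "f \<in> ?F" "f (unbar x) \<noteq> l" and y: "y \<in> set (x # v)" for f y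
  proof
    assume "f (unbar y) = l"
    hence "filter (\<lambda>z. f (unbar z) = l) v \<noteq> []" using f y by (auto simp: filter_empty_conv)
    then obtain z zs where z: "filter (\<lambda>z. f (unbar z) = l) v = z # zs"
      by (cases "filter (\<lambda>z. f (unbar z) = l) v") auto
    hence "inv_shuffle d ?\<sigma> f (x # v) = z # (zs @ inv_shuffle d \<sigma> f (x # v))"
      using f by (simp add: inv_shuffle_Cons_pattern)
    hence "z = x" using f by (simp add: fixed_labellings_def)
    moreover have "z \<in> set v" using z filter_is_subset[of "\<lambda>z. f (unbar z) = l" v] by auto
    ultimately show False using x by auto
  qed
  have "?F = A \<union> B" "A \<inter> B = {}" using miss by (auto simp: A_def B_def)
  moreover have "finite A" "finite B" by (simp_all add: A_def B_def finite_fixed_labellings)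
  ultimately have "card ?F = card A + card B" by (simp add: card_Un_disjoint)
  also have "B = fixed_labellings d \<sigma> (x # v)"
    unfolding B_def by (rule fixed_labellings_avoiding[OF l])
  also have "card A = card (fixed_labellings d ?\<sigma> v)"
  proof (rule bij_betw_same_card, rule bij_betw_byWitness
      [where f = "\<lambda>f. restrict f (unbar ` set v)" and f' = "\<lambda>f. f(unbar x := l)"])
    let ?i = "\<lambda>f. restrict f (unbar ` set v)" and ?j = "\<lambda>f. f(unbar x := l)"
    have upd: "inv_shuffle d ?\<sigma> (f(unbar x := l)) v = inv_shuffle d ?\<sigma> f v" for f
      using x by (intro inv_shuffle_cong) (auto simp: image_iff)
    have res: "inv_shuffle d ?\<sigma> (restrict f (unbar ` set v)) v = inv_shuffle d ?\<sigma> f v" for f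
      by (intro inv_shuffle_cong) auto
    show "\<forall>f\<in>A. ?j (?i f) = f"
      by (auto simp: A_def fixed_labellings_def fun_eq_iff PiE_iff extensional_def)
    show "\<forall>f\<in>fixed_labellings d ?\<sigma> v. ?i (?j f) = f"
      using x by (auto simp: fixed_labellings_def fun_eq_iff PiE_iff extensional_def)
    show "?i ` A \<subseteq> fixed_labellings d ?\<sigma> v"
    proof (rule image_subsetI)
      fix f assume "f \<in> A"
      thus "?i f \<in> fixed_labellings d ?\<sigma> v"
        using hit[of f] res[of f] unfolding A_def fixed_labellings_def
        by (auto simp: PiE_iff)
    qed
    show "?j ` fixed_labellings d ?\<sigma> v \<subseteq> A"
    proof (rule image_subsetI)
      fix f assume "f \<in> fixed_labellings d ?\<sigma> v"
      thus "?j f \<in> A"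
        using hit[of "?j f"] upd[of f] unfolding A_def fixed_labellings_def
        by (auto simp: PiE_iff extensional_def)
    qed
  qed
  finally show ?thesis .
qed

text \<open>With m plain piles and n letters the count is binomial(m + n - 1, n), the number of cuts
  into m consecutive, possibly empty pieces. Multiplying by the factorial avoids division.\<close>

lemma fact_mult_card_fixed_labellings:
  assumes "distinct (map fst \<sigma>)" "distinct (map unbar v)"
  shows "fact (length v) * card (fixed_labellings d \<sigma> v) = pochhammer (n_plain \<sigma>) (length v)"
  using assms
proof (induction \<sigma> arbitrary: v)
  \<comment> \<open>Without piles only the empty word has a labelling; this matches the rising
    factorial of 0.\<close>
  case Nil
  show ?case
    by (cases v) (auto simp: fixed_labellings_def inv_shuffle_def n_plain_def pochhammer_rec PiE_eq_empty_iff)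
next
  case (Cons p \<sigma>)
  obtain l s where p: "p = (l, s)" by (cases p)
  have l: "l \<notin> fst ` set \<sigma>" and \<sigma>: "distinct (map fst \<sigma>)" using Cons.prems by (auto simp: p)
  show ?case
  proof (cases s)
    case True
    thus ?thesis
      using Cons.IH[OF \<sigma> Cons.prems(2)] fixed_labellings_barred[OF l Cons.prems(2), of d]
      by (simp add: p n_plain_def)
  next
    case False
    have q: "n_plain (p # \<sigma>) = Suc (n_plain \<sigma>)" by (simp add: n_plain_def p False)
    show ?thesis using Cons.prems(2)
    proof (induction v)
      case Nil
      show ?case by (simp add: fixed_labellings_def)
    next
      case v: (Cons x v)
      let ?n = "length v" and ?m = "n_plain \<sigma>"
      have "fact (length (x # v)) * card (fixed_labellings d (p # \<sigma>) (x # v))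
          = Suc ?n * (fact ?n * card (fixed_labellings d (p # \<sigma>) v))
            + fact (length (x # v)) * card (fixed_labellings d \<sigma> (x # v))"
        using card_fixed_labellings_plain_Cons[OF l v.prems, of d]
        by (simp add: p False algebra_simps)
      also have "\<dots> = Suc ?n * pochhammer (Suc ?m) ?n + pochhammer ?m (Suc ?n)"
        using v Cons.IH[OF \<sigma> v.prems] q by simp
      \<comment> \<open>Both summands contain \<open>pochhammer (Suc ?m) ?n\<close>, with cofactors
        \<open>Suc ?n\<close> and \<open>?m\<close>; these add up to the last factor on the
        right.\<close>
      also have "\<dots> = pochhammer (Suc ?m) (Suc ?n)"
        unfolding pochhammer_rec[of ?m] pochhammer_Suc[of "Suc ?m"] by (simp add: algebra_simps)
      finally show ?case by (simp add: q)
    qed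
  qed
qed

section \<open>The number of signed permutations\<close>

lemma map_unbar_signed_perm:
  assumes "letter_content w = mset_set {1..n}"
  shows "map unbar w \<in> permutations_of_set {1..n}"
  using assms by (simp add: permutations_of_set_altdef permutations_of_multiset_def letter_content_def)

lemma signed_permD:
  assumes "letter_content w = mset_set {1..n}"
  shows "distinct (map unbar w)" "length w = n"
proof -
  show "distinct (map unbar w)"
    using map_unbar_signed_perm[OF assms] unfolding permutations_of_set_def by blast
  show "length w = n"
    using arg_cong[OF assms, of size] by (simp add: letter_content_def)
qed

text \<open>A signed permutation is an ordinary permutation of {1..n} with a bar flag for each
  position.\<close>

lemma card_signed_perms: "card {w. letter_content w = mset_set {1..n}} = 2 ^ n * fact n"
proof -
  let ?P = "permutations_of_set {1..n} \<times> {ss :: bool list. set ss \<subseteq> UNIV \<and> length ss = n}"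
  let ?i = "\<lambda>w. (map unbar w, map (\<lambda>x. x = Barred (unbar x)) w)"
  let ?l = "\<lambda>(k, s). if s then Barred k else Plain k"
  let ?j = "\<lambda>(ks, ss). map ?l (zip ks ss)"
  have len: "length ks = n" if "ks \<in> permutations_of_set {1..n}" for ks
    using length_finite_permutations_of_set[OF that] by simp
  have ub: "map unbar (map ?l (zip ks ss)) = ks" if "length ks = length ss" for ks ss
    using that by (induction ks ss rule: list_induct2) auto
  have bb: "map (\<lambda>x. x = Barred (unbar x)) (map ?l (zip ks ss)) = ss" if "length ks = length ss" for ks ss
    using that by (induction ks ss rule: list_induct2) auto
  have "bij_betw ?i {w. letter_content w = mset_set {1..n}} ?P"
  proof (rule bij_betw_byWitness[where f' = ?j])
    have "?l (unbar x, x = Barred (unbar x)) = x" for x by (cases x) auto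
    hence "map ?l (zip (map unbar w) (map (\<lambda>x. x = Barred (unbar x)) w)) = w" for w
      by (induction w) auto
    thus "\<forall>w\<in>{w. letter_content w = mset_set {1..n}}. ?j (?i w) = w" by simp
    show "\<forall>p\<in>?P. ?i (?j p) = p" using ub bb len by auto
    show "?i ` {w. letter_content w = mset_set {1..n}} \<subseteq> ?P"
      using map_unbar_signed_perm signed_permD(2) by auto
    show "?j ` ?P \<subseteq> {w. letter_content w = mset_set {1..n}}"
    proof (rule image_subsetI)
      fix p assume "p \<in> ?P"
      then obtain ks ss where p: "p = (ks, ss)" and ks: "ks \<in> permutations_of_set {1..n}" and "length ss = n"
        by auto
      hence "map unbar (map ?l (zip ks ss)) = ks" using ub len by simp
      hence "letter_content (map ?l (zip ks ss)) = mset ks" by (metis letter_content_def)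
      also have "\<dots> = mset_set {1..n}"
        using ks by (simp add: permutations_of_set_altdef permutations_of_multiset_def)
      finally show "?j p \<in> {w. letter_content w = mset_set {1..n}}" by (simp add: p)
    qed
  qed
  hence "card {w. letter_content w = mset_set {1..n}} = card ?P"
    by (rule bij_betw_same_card)
  thus ?thesis using card_lists_length_eq[of "UNIV :: bool set" n]
    by (simp add: card_cartesian_product)
qed

section \<open>The transition matrices\<close>

definition pattern_mat :: "word list \<Rightarrow> bool \<Rightarrow> ('l \<times> bool) list \<Rightarrow> complex mat" where
  "pattern_mat bs d \<sigma> = mat (length bs) (length bs)
     (\<lambda>(i, j). of_nat (inv_shuffle_count d \<sigma> (bs ! i) (bs ! j)))"

lemma pattern_mat_carrier [simp]: "pattern_mat bs d \<sigma> \<in> carrier_mat (length bs) (length bs)"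
  by (simp add: pattern_mat_def)

lemma sum_nth_distinct:
  assumes "distinct xs"
  shows "(\<Sum>k<length xs. f (xs ! k)) = (\<Sum>x\<in>set xs. f x)"
  using assms by (simp add: sum.reindex_bij_betw[OF bij_betw_nth])

locale signed_perm_basis =
  fixes n :: nat and bs :: "word list"
  assumes distinct_bs: "distinct bs" and set_bs: "set bs = {w. letter_content w = mset_set {1..n}}"
begin

lemma length_bs: "length bs = 2 ^ n * fact n"
  using distinct_card[OF distinct_bs] unfolding set_bs card_signed_perms by simp

lemma bs_nth:
  assumes "i < length bs"
  shows "letter_content (bs ! i) = mset_set {1..n}"
  using nth_mem[OF assms] by (simp add: set_bs)

text \<open>The row index is the word that the inverse shuffle starts from, so the left factor acts
  first and supplies the inner pattern.\<close>

lemma pattern_mat_mult: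
  assumes "distinct (map fst \<tau>)" "distinct (map fst \<sigma>)"
  shows "pattern_mat bs d \<sigma> * pattern_mat bs d \<tau> = pattern_mat bs d (comp_pattern d \<tau> \<sigma>)"
proof (rule eq_matI)
  fix i j assume "i < dim_row (pattern_mat bs d (comp_pattern d \<tau> \<sigma>))"
    and "j < dim_col (pattern_mat bs d (comp_pattern d \<tau> \<sigma>))"
  hence ij: "i < length bs" "j < length bs" by (auto simp: pattern_mat_def)
  let ?c = "\<lambda>u. inv_shuffle_count d \<sigma> (bs ! i) u * inv_shuffle_count d \<tau> u (bs ! j)"
  have cont: "set bs = {u. letter_content u = letter_content (bs ! i)}"
    using bs_nth[OF ij(1)] by (simp add: set_bs)
  have "(pattern_mat bs d \<sigma> * pattern_mat bs d \<tau>) $$ (i, j) = (\<Sum>k<length bs. of_nat (?c (bs ! k)))"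
    using ij by (subst index_mult_mat_sum[of _ "length bs"]) (auto simp: pattern_mat_def)
  also have "\<dots> = of_nat (\<Sum>u\<in>set bs. ?c u)"
    by (simp add: sum_nth_distinct[OF distinct_bs, of "\<lambda>u. of_nat (?c u)"] del: of_nat_mult)
  also have "(\<Sum>u\<in>set bs. ?c u) = inv_shuffle_count d (comp_pattern d \<tau> \<sigma>) (bs ! i) (bs ! j)"
    unfolding cont by (rule sum_inv_shuffle_count_mult[OF assms]) (simp flip: cont)
  finally show "(pattern_mat bs d \<sigma> * pattern_mat bs d \<tau>) $$ (i, j)
      = pattern_mat bs d (comp_pattern d \<tau> \<sigma>) $$ (i, j)"
    using ij by (simp add: pattern_mat_def)
qed (auto simp: pattern_mat_def)

lemma pattern_mat_one: "pattern_mat bs d [([], False)] = 1\<^sub>m (length bs)"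
proof (rule eq_matI)
  fix i j assume ij: "i < dim_row (1\<^sub>m (length bs))" "j < dim_col (1\<^sub>m (length bs))"
  let ?D = "unbar ` set (bs ! i)"
  let ?e = "\<lambda>i\<in>?D. []"
  have id: "inv_shuffle d [([], False)] f (bs ! i) = bs ! i" if "f \<in> ?D \<rightarrow>\<^sub>E {[]}" for f
    using that by (auto simp: inv_shuffle_def filter_id_conv)
  have "?D \<rightarrow>\<^sub>E {[]} = {?e}"
    by (auto simp: fun_eq_iff PiE_iff extensional_def)
  hence eq: "{f \<in> ?D \<rightarrow>\<^sub>E {[]}. inv_shuffle d [([], False)] f (bs ! i) = bs ! j}
       = (if bs ! i = bs ! j then {?e} else {})"
    using id by (auto split: if_splits)
  have count: "inv_shuffle_count d [([], False)] (bs ! i) (bs ! j) = (if bs ! i = bs ! j then 1 else 0)"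
    unfolding inv_shuffle_count_def list.set image_insert image_empty fst_conv eq by simp
  show "pattern_mat bs d [([], False)] $$ (i, j) = 1\<^sub>m (length bs) $$ (i, j)"
    using ij distinct_bs by (simp add: pattern_mat_def count nth_eq_iff_index_eq)
qed (auto simp: pattern_mat_def)

lemma smult_pattern_mat_pow:
  assumes "distinct (map fst \<tau>)"
  shows "(c \<cdot>\<^sub>m pattern_mat bs d \<tau>) ^\<^sub>m j = c ^ j \<cdot>\<^sub>m pattern_mat bs d (pow_pattern d \<tau> j)"
proof (induction j)
  case 0
  have "dim_row (pattern_mat bs d \<tau>) = length bs" by (simp add: pattern_mat_def)
  thus ?case by (auto simp: pattern_mat_one)
next
  case (Suc j)
  let ?P = "pattern_mat bs d (pow_pattern d \<tau> j)" and ?Q = "pattern_mat bs d \<tau>"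
  have "(c \<cdot>\<^sub>m ?Q) ^\<^sub>m Suc j = (c ^ j \<cdot>\<^sub>m ?P) * (c \<cdot>\<^sub>m ?Q)" by (simp add: Suc)
  also have "\<dots> = c ^ j \<cdot>\<^sub>m (c \<cdot>\<^sub>m (?P * ?Q))"
    by (subst mult_smult_assoc_mat[of _ "length bs" "length bs" _ "length bs"])
      (simp_all add: mult_smult_distrib[of _ "length bs" "length bs" _ "length bs"])
  also have "?P * ?Q = pattern_mat bs d (pow_pattern d \<tau> (Suc j))"
    using assms by (simp add: pattern_mat_mult distinct_pow_pattern)
  also have "c ^ j \<cdot>\<^sub>m (c \<cdot>\<^sub>m A) = c ^ Suc j \<cdot>\<^sub>m A" for A by (rule eq_matI) auto
  finally show ?case .
qed

text \<open>All 2^n n! basis words have the same number of fixed labellings, a rising factorial over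
  n!, so the factorials cancel.\<close>

lemma mat_trace_pattern_mat:
  assumes "distinct (map fst \<sigma>)"
  shows "mat_trace (pattern_mat bs d \<sigma>) = of_nat (2 ^ n * pochhammer (n_plain \<sigma>) n)"
proof -
  have "fact n * (\<Sum>i<length bs. inv_shuffle_count d \<sigma> (bs ! i) (bs ! i))
      = (\<Sum>i<length bs. pochhammer (n_plain \<sigma>) n)"
    unfolding sum_distrib_left
  proof (rule sum.cong)
    fix i assume "i \<in> {..<length bs}"
    hence "letter_content (bs ! i) = mset_set {1..n}" by (simp add: bs_nth)
    note v = signed_permD[OF this]
    show "fact n * inv_shuffle_count d \<sigma> (bs ! i) (bs ! i) = pochhammer (n_plain \<sigma>) n"
      using fact_mult_card_fixed_labellings[OF assms v(1), of d] v(2)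
      by (simp add: fixed_labellings_def inv_shuffle_count_def)
  qed simp
  also have "\<dots> = fact n * (2 ^ n * pochhammer (n_plain \<sigma>) n)"
    by (simp add: length_bs)
  finally have "(\<Sum>i<length bs. inv_shuffle_count d \<sigma> (bs ! i) (bs ! i)) = 2 ^ n * pochhammer (n_plain \<sigma>) n"
    by simp
  thus ?thesis
    by (simp add: mat_trace_def pattern_mat_def flip: of_nat_sum)
qed

lemma matrix_on_alt_op:
  assumes "a \<ge> 1"
  shows "matrix_on bs (normalized n a (alt_op d s a))
       = (1 / of_nat a ^ n) \<cdot>\<^sub>m pattern_mat bs d (map (\<lambda>l. (l, s l)) [0..<a])"
proof (rule eq_matI)
  fix i j
  assume "i < dim_row ((1 / of_nat a ^ n) \<cdot>\<^sub>m pattern_mat bs d (map (\<lambda>l. (l, s l)) [0..<a]))"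
    "j < dim_col ((1 / of_nat a ^ n) \<cdot>\<^sub>m pattern_mat bs d (map (\<lambda>l. (l, s l)) [0..<a]))"
  hence ij: "i < length bs" "j < length bs" by (auto simp: pattern_mat_def)
  show "matrix_on bs (normalized n a (alt_op d s a)) $$ (i, j)
      = ((1 / of_nat a ^ n) \<cdot>\<^sub>m pattern_mat bs d (map (\<lambda>l. (l, s l)) [0..<a])) $$ (i, j)"
    using ij lookup_alt_op[OF assms signed_permD(1)[OF bs_nth[OF ij(1)]]]
    by (simp add: matrix_on_def normalized_def pattern_mat_def)
qed (auto simp: matrix_on_def pattern_mat_def)

text \<open>Here \<open>\<epsilon>\<close> is the number of plain minus the number of barred piles.
  The factor 2^n of the trace is spread over the n factors of the rising factorial, so that only
  twice the plain count enters.\<close>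

lemma power_sum_eigenvalues_alt_op:
  fixes s :: "nat \<Rightarrow> bool"
  assumes a: "a \<ge> 1"
  defines "\<epsilon> \<equiv> (\<Sum>l<a. if s l then - 1 else 1 :: int)"
  shows "(\<Sum>z\<in>#eigenvalue_mset (matrix_on bs (normalized n a (alt_op d s a))). z ^ j)
       = of_int (\<Prod>i<n. int a ^ j + \<epsilon> ^ j + 2 * int i) / of_nat a ^ (n * j)"
proof -
  let ?\<tau> = "map (\<lambda>l. (l, s l)) [0..<a]"
  let ?\<sigma> = "pow_pattern d ?\<tau> j"
  have \<tau>: "distinct (map fst ?\<tau>)" by (simp add: o_def)
  have "int (n_plain ?\<tau>) - int (n_barred ?\<tau>) = \<epsilon>"
    unfolding \<epsilon>_def by (induction a) (auto simp: n_plain_def n_barred_def)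
  hence pp: "2 * int (n_plain ?\<sigma>) = int a ^ j + \<epsilon> ^ j"
    using n_plain_pow_pattern[of d ?\<tau> j] by simp
  have "matrix_on bs (normalized n a (alt_op d s a)) \<in> carrier_mat (length bs) (length bs)"
    by (simp add: matrix_on_def)
  hence "(\<Sum>z\<in>#eigenvalue_mset (matrix_on bs (normalized n a (alt_op d s a))). z ^ j)
      = mat_trace ((1 / of_nat a ^ n) ^ j \<cdot>\<^sub>m pattern_mat bs d ?\<sigma>)"
    by (simp only: sum_eigenvalue_mset_power matrix_on_alt_op[OF a] smult_pattern_mat_pow[OF \<tau>])
  also have "\<dots> = (1 / of_nat a ^ n) ^ j * mat_trace (pattern_mat bs d ?\<sigma>)"
    by (simp add: mat_trace_def sum_distrib_left pattern_mat_def)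
  also have "mat_trace (pattern_mat bs d ?\<sigma>) = of_int (\<Prod>i<n. 2 * int (n_plain ?\<sigma>) + 2 * int i)"
  proof -
    have "int (2 ^ n * pochhammer (n_plain ?\<sigma>) n) = (\<Prod>i<n. 2 * int (n_plain ?\<sigma>) + 2 * int i)"
      unfolding distrib_left[symmetric] prod.distrib by (simp add: pochhammer_prod atLeast0LessThan)
    from arg_cong[OF this, of "of_int :: int \<Rightarrow> complex"] show ?thesis
      unfolding mat_trace_pattern_mat[OF distinct_pow_pattern[OF \<tau>]] by (simp only: of_int_of_nat_eq)
  qed
  finally show ?thesis by (simp add: pp power_divide power_mult)
qed

end

section \<open>Power sums of the claimed eigenvalues\<close>

lemma sum_mset_image_sum:
  "(\<Sum>z\<in>#(\<Sum>k\<in>K. M k). f z) = (\<Sum>k\<in>K. \<Sum>z\<in>#M k. f z :: 'a::comm_monoid_add)"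
  by (induction K rule: infinite_finite_induct) auto

text \<open>The j-th power of a^(k-n) is (a^j)^k / a^(n j), so weighting by the coefficients
  evaluates \<open>p\<close> at a^j. The degree bound ensures that k \<le> n reaches every nonzero
  coefficient.\<close>

lemma power_sum_replicate_coeffs:
  fixes p :: "nat poly" and e :: complex
  assumes "degree p \<le> n" "a \<ge> 1"
  shows "(\<Sum>z\<in>#(\<Sum>k\<le>n. replicate_mset (coeff p k) (e * of_nat a powi (int k - int n))). z ^ j)
       = e ^ j * of_nat (poly p (a ^ j)) / of_nat a ^ (n * j)"
proof -
  have "(\<Sum>z\<in>#(\<Sum>k\<le>n. replicate_mset (coeff p k) (e * of_nat a powi (int k - int n))). z ^ j)
      = (\<Sum>k\<le>n. of_nat (coeff p k) * (e * of_nat a powi (int k - int n)) ^ j)"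
    by (simp add: sum_mset_image_sum)
  also have "\<dots> = (\<Sum>k\<le>n. e ^ j / of_nat a ^ (n * j) * of_nat (coeff p k * (a ^ j) ^ k))"
    using assms(2)
    by (intro sum.cong) (simp_all add: power_int_diff power_divide power_mult_distrib mult.commute
        flip: power_mult)
  also have "\<dots> = e ^ j / of_nat a ^ (n * j) * of_nat (\<Sum>k\<le>n. coeff p k * (a ^ j) ^ k)"
    by (simp add: sum_distrib_left)
  also have "(\<Sum>k\<le>n. coeff p k * (a ^ j) ^ k) = poly p (a ^ j)"
    unfolding poly_altdef using assms(1)
    by (intro sum.mono_neutral_right) (auto simp: coeff_eq_0)
  finally show ?thesis by simp
qed

lemma degree_prod_linear_le:
  fixes c :: "nat \<Rightarrow> 'a::comm_semiring_1"
  shows "degree (\<Prod>i<n. [:c i, 1:]) \<le> n"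
  using degree_prod_sum_le[of "{..<n}" "\<lambda>i. [:c i, 1:]"] by simp

text \<open>This is (2n-1)!! (2n)!! = (2n)!; it identifies the quotient in the multiplicity of the
  eigenvalue 0.\<close>

lemma prod_odd_numbers: "(\<Prod>i<n. 2 * i + 1 :: nat) * (2 ^ n * fact n) = fact (2 * n)"
proof (induction n)
  case (Suc n)
  have "fact (2 * Suc n) = (2 * n + 2) * (2 * n + 1) * (fact (2 * n) :: nat)"
    by (simp add: algebra_simps)
  also have "\<dots> = (\<Prod>i<Suc n. 2 * i + 1) * (2 ^ Suc n * fact (Suc n))"
    unfolding Suc[symmetric] by (simp add: algebra_simps)
  finally show ?case by simp
qed simp

lemma prod_even_numbers: "(\<Prod>i<n. 2 * i + 2 :: nat) = 2 ^ n * fact n"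
  by (induction n) (simp_all add: algebra_simps)

lemma sum_alternating_signs:
  fixes a :: nat
  shows "(\<Sum>l<a. if odd l then - 1 else 1 :: int) = of_bool (odd a)"
  "(\<Sum>l<a. if even l then - 1 else 1 :: int) = - of_bool (odd a)"
proof -
  show "(\<Sum>l<a. if odd l then - 1 else 1 :: int) = of_bool (odd a)"
    by (induction a) auto
  show "(\<Sum>l<a. if even l then - 1 else 1 :: int) = - of_bool (odd a)"
    by (induction a) auto
qed

theorem theorem5p10:
  fixes n a N :: nat and bs :: "word list"
  assumes n: "n \<ge> 1" and a: "a \<ge> 1" and N: "N \<ge> n"
    and bs: "distinct bs" "set bs = signed_perms N n"
  shows
    "(even a \<longrightarrow>
       (\<forall>T \<in> {theta_plus rot a, theta_minus rot a, theta_plus flip a, theta_minus flip a}.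
          eigenvalue_mset (matrix_on bs (normalized n a T)) =
            (\<Sum>k\<le>n. replicate_mset (coeff (\<Prod>i<n. [:2 * i, 1:]) k)
                                   (of_nat a powi (int k - int n)))
            + replicate_mset (2 ^ n * fact n - fact (2 * n) div (2 ^ n * fact n)) 0)) \<and>
     (odd a \<longrightarrow>
       (\<forall>T \<in> {theta_plus rot a, theta_plus flip a}.
          eigenvalue_mset (matrix_on bs (normalized n a T)) =
            (\<Sum>k\<le>n. replicate_mset (coeff (\<Prod>i<n. [:2 * i + 1, 1:]) k)
                                   (of_nat a powi (int k - int n))))) \<and>
     (odd a \<longrightarrow>
       (\<forall>T \<in> {theta_minus rot a, theta_minus flip a}.
          eigenvalue_mset (matrix_on bs (normalized n a T)) =
            (\<Sum>k\<le>n. replicate_mset (coeff ([:n - 1, 1:] * (\<Prod>i<n - 1. [:2 * i + 1, 1:])) k)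
                                   (of_nat a powi (int k - int n)))
            + (\<Sum>k\<le>n. replicate_mset (coeff ([:n:] * (\<Prod>i<n - 1. [:2 * i + 1, 1:])) k)
                                     (- (of_nat a powi (int k - int n))))))"
proof -
  interpret signed_perm_basis n bs
    by unfold_locales (use bs signed_perms_eq[OF N] in auto)
  let ?E = "\<lambda>d s. eigenvalue_mset (matrix_on bs (normalized n a (alt_op d s a)))"
  note power_sum_plain = power_sum_replicate_coeffs[where e = 1, unfolded mult_1 power_one]
  note power_sum_minus = power_sum_replicate_coeffs[where e = "- 1", unfolded mult_minus1]
  have even_case: "?E d s = (\<Sum>k\<le>n. replicate_mset (coeff (\<Prod>i<n. [:2 * i, 1:]) k)
        (of_nat a powi (int k - int n)))
      + replicate_mset (2 ^ n * fact n - fact (2 * n) div (2 ^ n * fact n)) 0"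
    if a2: "even a" and s: "s = even \<or> s = odd" for d s
  proof (rule multiset_eqI_power_sums)
    fix j
    let ?m = "2 ^ n * fact n - fact (2 * n) div (2 ^ n * fact n) :: nat"
    have eps: "(\<Sum>l<a. if s l then - 1 else 1 :: int) = 0"
      using s a2 sum_alternating_signs[of a] by auto
    \<comment> \<open>The quotient is (2n-1)!!, at most (2n)!! = 2^n n!, so the subtraction in
      \<open>?m\<close> does not truncate.\<close>
    have "fact (2 * n) div (2 ^ n * fact n) = (\<Prod>i<n. 2 * i + 1 :: nat)"
      using prod_odd_numbers[of n] by (metis div_mult_self_is_m fact_gt_zero nat_0_less_mult_iff zero_less_numeral zero_less_power)
    moreover have "(\<Prod>i<n. 2 * i + 1 :: nat) \<le> 2 ^ n * fact n"
      unfolding prod_even_numbers[symmetric] by (intro prod_mono) auto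
    ultimately have zeros: "(\<Prod>i<n. 2 * i + 1) + ?m = (\<Prod>i<n. 2 * i + 2 :: nat)"
      unfolding prod_even_numbers by simp
    \<comment> \<open>For \<epsilon> = 0 the term \<open>0 ^ j\<close> matters only at j = 0, where
      it raises each factor from 2i + 1 to 2i + 2. The \<open>?m\<close> zero eigenvalues, visible
      only in that power sum, account for the difference.\<close>
    have "int (\<Prod>i<n. 2 * i + a ^ j) + int ?m * 0 ^ j = (\<Prod>i<n. int a ^ j + 0 ^ j + 2 * int i)"
    proof (cases "j = 0")
      case True
      have "int (\<Prod>i<n. 2 * i + 1) + int ?m = int (\<Prod>i<n. 2 * i + 2)"
        unfolding zeros[symmetric] of_nat_add ..
      also have "\<dots> = (\<Prod>i<n. 2 + 2 * int i)"
        by (simp add: add.commute)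
      finally show ?thesis using True by (simp del: of_nat_diff of_nat_prod)
    qed (simp add: add.commute power_0_left)
    from arg_cong[OF this, of "of_int :: int \<Rightarrow> complex"]
    have cplx: "of_nat (\<Prod>i<n. 2 * i + a ^ j) + of_nat ?m * 0 ^ j
        = (of_int (\<Prod>i<n. int a ^ j + 0 ^ j + 2 * int i) :: complex)"
      by (simp only: of_int_add of_int_mult of_int_power of_int_of_nat_eq of_int_0)
    have pol: "poly (\<Prod>i<n. [:2 * i, 1:]) (a ^ j) = (\<Prod>i<n. 2 * i + a ^ j)"
      by (simp add: poly_prod)
    show "(\<Sum>z\<in>#?E d s. z ^ j) = (\<Sum>z\<in>#(\<Sum>k\<le>n. replicate_mset (coeff (\<Prod>i<n. [:2 * i, 1:]) k)
        (of_nat a powi (int k - int n)))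
      + replicate_mset (2 ^ n * fact n - fact (2 * n) div (2 ^ n * fact n)) 0. z ^ j)"
      unfolding power_sum_eigenvalues_alt_op[OF a] eps cplx[symmetric] image_mset_union sum_mset.union
        power_sum_plain[OF degree_prod_linear_le a] pol image_replicate_mset sum_mset_replicate_mset
      using a by (cases "j = 0") (simp_all add: add_divide_distrib power_0_left)
  qed
  have odd_plus: "?E d odd = (\<Sum>k\<le>n. replicate_mset (coeff (\<Prod>i<n. [:2 * i + 1, 1:]) k)
        (of_nat a powi (int k - int n)))" if "odd a" for d
  proof (rule multiset_eqI_power_sums)
    fix j
    have eps: "(\<Sum>l<a. if odd l then - 1 else 1 :: int) = 1"
      using that sum_alternating_signs[of a] by auto
    \<comment> \<open>For \<epsilon> = 1 the trace product is the claimed polynomial evaluated at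
      a^j, for every j.\<close>
    have "int (\<Prod>i<n. 2 * i + 1 + a ^ j) = (\<Prod>i<n. int a ^ j + 1 ^ j + 2 * int i)"
      by (simp add: algebra_simps)
    from arg_cong[OF this, of "of_int :: int \<Rightarrow> complex"]
    have cplx: "of_nat (\<Prod>i<n. 2 * i + 1 + a ^ j)
        = (of_int (\<Prod>i<n. int a ^ j + 1 ^ j + 2 * int i) :: complex)"
      by (simp only: of_int_of_nat_eq)
    have pol: "poly (\<Prod>i<n. [:2 * i + 1, 1:]) (a ^ j) = (\<Prod>i<n. 2 * i + 1 + a ^ j)"
      by (simp add: poly_prod)
    show "(\<Sum>z\<in>#?E d odd. z ^ j) = (\<Sum>z\<in>#(\<Sum>k\<le>n. replicate_mset (coeff (\<Prod>i<n. [:2 * i + 1, 1:]) k)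
        (of_nat a powi (int k - int n))). z ^ j)"
      unfolding power_sum_eigenvalues_alt_op[OF a] eps cplx[symmetric]
        power_sum_plain[OF degree_prod_linear_le a] pol ..
  qed
  have odd_minus: "?E d even =
      (\<Sum>k\<le>n. replicate_mset (coeff ([:n - 1, 1:] * (\<Prod>i<n - 1. [:2 * i + 1, 1:])) k)
        (of_nat a powi (int k - int n)))
      + (\<Sum>k\<le>n. replicate_mset (coeff ([:n:] * (\<Prod>i<n - 1. [:2 * i + 1, 1:])) k)
        (- (of_nat a powi (int k - int n))))" if "odd a" for d
  proof (rule multiset_eqI_power_sums)
    fix j
    obtain m where m: "n = Suc m" using n by (cases n) auto
    let ?Q = "\<Prod>i<n - 1. [:2 * i + 1, 1:] :: nat poly" and ?q = "\<Prod>i<m. 2 * i + 1 + a ^ j"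
    have eps: "(\<Sum>l<a. if even l then - 1 else 1 :: int) = - 1"
      using that sum_alternating_signs[of a] by auto
    have degQ: "degree ?Q \<le> n - 1" by (rule degree_prod_linear_le)
    have deg: "degree ([:c, e:] * ?Q) \<le> n" for c e
    proof -
      have "degree ([:c, e:] * ?Q) \<le> degree [:c, e:] + degree ?Q" by (rule degree_mult_le)
      also have "\<dots> \<le> 1 + (n - 1)" using degQ by (intro add_mono) simp_all
      finally show ?thesis using n by simp
    qed
    have deg0: "degree ([:n:] * ?Q) \<le> n"
      using deg[of n 0] by (simp only: pCons_0_0)
    have pol: "poly ([:n - 1, 1:] * ?Q) (a ^ j) = (m + a ^ j) * ?q" "poly ([:n:] * ?Q) (a ^ j) = n * ?q"
      by (simp_all add: m poly_prod del: prod.lessThan_Suc mult_pCons_left)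
    \<comment> \<open>The left side is \<open>?q\<close> times m + a^j + n for even j and m + a^j -
      n for odd j. As n = m + 1, the first is a^j + 1 + 2m, the last factor on the right; the second
      is a^j - 1, the first factor there. The remaining factors form \<open>?q\<close>, after an
      index shift when j is odd.\<close>
    have "int ((m + a ^ j) * ?q) + (- 1) ^ j * int (n * ?q)
        = (\<Prod>i<n. int a ^ j + (- 1) ^ j + 2 * int i)"
    proof (cases "even j")
      case True
      have "(\<Prod>i<n. int a ^ j + (- 1) ^ j + 2 * int i)
          = (\<Prod>i<m. int a ^ j + 1 + 2 * int i) * (int a ^ j + 1 + 2 * int m)"
        using True by (simp add: m)
      thus ?thesis using True by (simp add: m algebra_simps)
    next
      case False
      have "(\<Prod>i<n. int a ^ j + (- 1) ^ j + 2 * int i)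
          = (int a ^ j - 1) * (\<Prod>i<m. int a ^ j - 1 + 2 * int (Suc i))"
        using False by (simp add: m prod.lessThan_Suc_shift del: prod.lessThan_Suc)
      thus ?thesis using False by (simp add: m algebra_simps)
    qed
    from arg_cong[OF this, of "of_int :: int \<Rightarrow> complex"]
    have cplx: "of_nat ((m + a ^ j) * ?q) + (- 1) ^ j * of_nat (n * ?q)
        = (of_int (\<Prod>i<n. int a ^ j + (- 1) ^ j + 2 * int i) :: complex)"
      by (simp only: of_int_add of_int_mult of_int_power of_int_of_nat_eq of_int_minus of_int_1)
    show "(\<Sum>z\<in>#?E d even. z ^ j) =
        (\<Sum>z\<in>#(\<Sum>k\<le>n. replicate_mset (coeff ([:n - 1, 1:] * ?Q) k) (of_nat a powi (int k - int n)))
          + (\<Sum>k\<le>n. replicate_mset (coeff ([:n:] * ?Q) k) (- (of_nat a powi (int k - int n)))). z ^ j)"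
      unfolding power_sum_eigenvalues_alt_op[OF a] eps cplx[symmetric] image_mset_union sum_mset.union
        power_sum_plain[OF deg a] power_sum_minus[OF deg0 a] pol add_divide_distrib ..
  qed
  show ?thesis
    using even_case odd_plus odd_minus
    by (simp add: theta_eq_alt_op flip: turn_eq)
qed

end
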